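(* Let $\alpha\in(0,1)$ and $\gamma\in(0,1-\alpha)$ be fixed constants. There exist constants $\xi=\xi(\alpha,\gamma)>0$ and $c=c(\alpha,\gamma)>0$ such that, with probability $1-o(1)$ as $n\to\infty$ over the random graph $G\sim\mathcal{G}(n,\frac12,k=\lfloor n^\alpha\rfloor)$ with planted clique $\mathcal{PC}$, the following holds. For every $1$-Lipschitz $h:[n]\to\mathbb{R}$ with $h_0=0$, every inverse temperature $0\le\beta\le(\ln 2)\gamma\log n$, and every clique $C\in\Omega(G)$ of size at most $\xi\log n$, the Metropolis process $\{X_t\}$ on $G$ with stationary distribution $\pi_\beta$ satisfies $$\Pr\big(\exists\, t\in\mathbb{N},\ t\le n^{c\log n}:\ |X_t\cap\mathcal{PC}|\ge\gamma\log n\,\big|\,X_0=C\big)\le n^{-c\log n}.$$ In particular, the Metropolis process starting from the empty clique requires $n^{\Omega(\log n)}$ steps to reach cliques of intersection with the planted clique at least $\gamma\log n$, with probability $1-n^{-\Omega(\log n)}$. As a consequence, it fails to recover the planted clique in polynomial time.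
   Context: Conventions: $\log$ is the base-2 logarithm, $\ln$ the natural logarithm; $[n]=\{0,1,\dots,n\}$. Planted clique model: $\mathcal{G}(n,\frac12,k)$ is the random graph on an $n$-element vertex set $V$ obtained by sampling $\mathcal{G}(n,\frac12)$ (each pair is an edge independently with probability $1/2$), choosing a uniformly random $k$-subset $\mathcal{PC}\subseteq V$ (the planted clique), and adding all edges between vertices of $\mathcal{PC}$. $\Omega(G)$ denotes the set of all cliques of $G$, i.e. vertex subsets (including $\emptyset$) whose vertices are pairwise adjacent. Gibbs measure: for $h:[n]\to\mathbb{R}$, written $h_q=h(q)$, and inverse temperature $\beta$, $\pi_\beta(C)\propto\exp(\beta h_{|C|})$ for $C\in\Omega(G)$. "$h$ is $1$-Lipschitz" means $|h_q-h_{q'}|\le|q-q'|$ for all $q,q'\in[n]$ with $q,q'\le 2.1\log n$. Metropolis process: the Markov chain $\{X_t\}$ on $\Omega(G)$ which at step $t$ picks $v\in V$ uniformly at random and sets $C'=X_{t-1}\oplus\{v\}$ (symmetric difference). If $C'\in\Omega(G)$, then $X_t=C'$ with probability $\min\{1,\exp(\beta(h_{|C'|}-h_{|X_{t-1}|}))\}$ and $X_t=X_{t-1}$ otherwise. If $C'\notin\Omega(G)$, then $X_t=X_{t-1}$. Recovering the planted clique means reaching the state $X_t=\mathcal{PC}$. *)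

theory Defs
  imports "HOL-Probability.Probability"
begin

text \<open>A graph on a vertex set \<open>V\<close> is given by its edge set, a set of two-element subsets of \<open>V\<close>.\<close>

definition vertex_pairs :: "'v set \<Rightarrow> 'v set set" where
  "vertex_pairs V = {e. e \<subseteq> V \<and> card e = 2}"

definition cliques :: "'v set \<Rightarrow> 'v set set \<Rightarrow> 'v set set" where
  "cliques V E = {C. C \<subseteq> V \<and> (\<forall>u\<in>C. \<forall>v\<in>C. u \<noteq> v \<longrightarrow> {u, v} \<in> E)}"

definition random_graph :: "'v set \<Rightarrow> real \<Rightarrow> 'v set set pmf" where
  "random_graph V p =
     map_pmf (\<lambda>f. {e \<in> vertex_pairs V. f e})
       (Pi_pmf (vertex_pairs V) False (\<lambda>_. bernoulli_pmf p))"

text \<open>The joint law of the edge set of the planted graph and the planted clique. It is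
  meaningful for \<open>k \<le> card V\<close> only.\<close>

definition planted_clique_model :: "'v set \<Rightarrow> nat \<Rightarrow> ('v set set \<times> 'v set) pmf" where
  "planted_clique_model V k =
     do {
       E \<leftarrow> random_graph V (1 / 2);
       PC \<leftarrow> pmf_of_set {K. K \<subseteq> V \<and> card K = k};
       return_pmf (E \<union> vertex_pairs PC, PC)
     }"

definition planted_power_model :: "real \<Rightarrow> nat \<Rightarrow> (nat set set \<times> nat set) pmf" where
  "planted_power_model \<alpha> n = planted_clique_model {..<n} (nat \<lfloor>real n powr \<alpha>\<rfloor>)"

definition whp :: "(nat \<Rightarrow> 'a pmf) \<Rightarrow> (nat \<Rightarrow> 'a \<Rightarrow> bool) \<Rightarrow> bool" where
  "whp M P \<longleftrightarrow> (\<lambda>n. measure_pmf.prob (M n) {x. P n x}) \<longlonglongrightarrow> 1"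

text \<open>A function on \<open>{0, \<dots>, n}\<close> is represented by a function on all natural numbers whose
  values beyond \<open>n\<close> are never used. The Lipschitz condition constrains only arguments up to
  \<open>2.1 log n\<close>.\<close>

definition one_lipschitz :: "nat \<Rightarrow> (nat \<Rightarrow> real) \<Rightarrow> bool" where
  "one_lipschitz n h \<longleftrightarrow>
     (\<forall>q\<le>n. \<forall>q'\<le>n. real q \<le> 2.1 * log 2 (real n) \<longrightarrow> real q' \<le> 2.1 * log 2 (real n) \<longrightarrow>
        \<bar>h q - h q'\<bar> \<le> \<bar>real q - real q'\<bar>)"

definition gibbs :: "'v set \<Rightarrow> 'v set set \<Rightarrow> (nat \<Rightarrow> real) \<Rightarrow> real \<Rightarrow> 'v set \<Rightarrow> real" where
  "gibbs V E h \<beta> C =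
     (if C \<in> cliques V E
      then exp (\<beta> * h (card C)) / (\<Sum>D\<in>cliques V E. exp (\<beta> * h (card D)))
      else 0)"

definition metropolis_step ::
    "'v set \<Rightarrow> 'v set set \<Rightarrow> (nat \<Rightarrow> real) \<Rightarrow> real \<Rightarrow> 'v set \<Rightarrow> 'v set pmf" where
  "metropolis_step V E h \<beta> X =
     do {
       v \<leftarrow> pmf_of_set V;
       let C' = sym_diff X {v};
       if C' \<in> cliques V E
       then do {
         accept \<leftarrow> bernoulli_pmf (min 1 (exp (\<beta> * (h (card C') - h (card X)))));
         return_pmf (if accept then C' else X)
       }
       else return_pmf X
     }"

text \<open>The law of the initial segment \<open>[X\<^sub>0, \<dots>, X\<^sub>T]\<close> of the Metropolis process started at
  \<open>X\<^sub>0 = C\<close>. The event that some property holds at a time \<open>t \<le> T\<close> depends on this segment only.\<close>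

primrec metropolis_path ::
    "'v set \<Rightarrow> 'v set set \<Rightarrow> (nat \<Rightarrow> real) \<Rightarrow> real \<Rightarrow> 'v set \<Rightarrow> nat \<Rightarrow> 'v set list pmf" where
  "metropolis_path V E h \<beta> C 0 = return_pmf [C]"
| "metropolis_path V E h \<beta> C (Suc T) =
     do {
       Xs \<leftarrow> metropolis_path V E h \<beta> C T;
       Y \<leftarrow> metropolis_step V E h \<beta> (last Xs);
       return_pmf (Xs @ [Y])
     }"

text \<open>The Metropolis process is reversible with respect to the Gibbs measure, which is
  therefore stationary.\<close>

lemma finite_cliques: "finite V \<Longrightarrow> finite (cliques V E)"
  by (rule finite_subset[of _ "Pow V"]) (auto simp: cliques_def)

lemma empty_in_cliques: "{} \<in> cliques V E"
  by (simp add: cliques_def)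

lemma gibbs_nonneg: "gibbs V E h \<beta> C \<ge> 0"
  by (auto simp: gibbs_def intro!: divide_nonneg_nonneg sum_nonneg)

lemma sum_gibbs:
  assumes "finite V"
  shows "(\<Sum>C\<in>cliques V E. gibbs V E h \<beta> C) = 1"
proof -
  have "(\<Sum>D\<in>cliques V E. exp (\<beta> * h (card D))) > 0"
    using finite_cliques[OF assms] empty_in_cliques[of V E] by (intro sum_pos) auto
  then show ?thesis
    by (simp add: gibbs_def flip: sum_divide_distrib)
qed

lemma gibbs_reversible:
  assumes "finite V" "V \<noteq> {}"
  shows "gibbs V E h \<beta> X * pmf (metropolis_step V E h \<beta> X) Y =
         gibbs V E h \<beta> Y * pmf (metropolis_step V E h \<beta> Y) X"
proof (cases "X = Y")
  case False
  define S where "S = (\<lambda>X v. let C' = sym_diff X {v} in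
       if C' \<in> cliques V E
       then bind_pmf (bernoulli_pmf (min 1 (exp (\<beta> * (h (card C') - h (card X))))))
         (\<lambda>accept. return_pmf (if accept then C' else X))
       else return_pmf X)"
  have S: "pmf (S A v) B =
      (if B \<in> cliques V E \<and> B = sym_diff A {v}
       then min 1 (exp (\<beta> * (h (card B) - h (card A)))) else 0)"
    if "A \<noteq> B" for A B v
  proof -
    have *: "pmf (bind_pmf (bernoulli_pmf p) (\<lambda>b. return_pmf (if b then D else A))) F =
        (if F = D then p else 0)" if "0 \<le> p" "p \<le> 1" "A \<noteq> F" for p D F
      using that by (simp add: pmf_bind integral_bernoulli_pmf)
    obtain D where D: "D = sym_diff A {v}" by blast
    show ?thesis
      unfolding S_def Let_def D[symmetric] using \<open>A \<noteq> B\<close> by (auto simp: *)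
  qed
  have step: "pmf (metropolis_step V E h \<beta> A) B = (\<Sum>v\<in>V. pmf (S A v) B) / card V" for A B
    unfolding metropolis_step_def S_def using assms by (simp add: pmf_bind_pmf_of_set)
  have flip: "Y = sym_diff X {v} \<longleftrightarrow> X = sym_diff Y {v}" for v
    by blast
  have metro: "exp a * min 1 (exp (b - a)) = exp b * min 1 (exp (a - b))" for a b :: real
    by (auto simp: min_def exp_diff)
  have "gibbs V E h \<beta> X * pmf (S X v) Y = gibbs V E h \<beta> Y * pmf (S Y v) X" for v
    using metro[of "\<beta> * h (card X)" "\<beta> * h (card Y)"] False flip[of v]
    by (auto simp: S gibbs_def right_diff_distrib)
  then have "gibbs V E h \<beta> X * (\<Sum>v\<in>V. pmf (S X v) Y) = gibbs V E h \<beta> Y * (\<Sum>v\<in>V. pmf (S Y v) X)"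
    by (simp add: sum_distrib_left)
  then show ?thesis
    by (simp add: step)
qed simp

lemma gibbs_stationary:
  assumes "finite V" "V \<noteq> {}"
  shows "(\<Sum>X\<in>cliques V E. gibbs V E h \<beta> X * pmf (metropolis_step V E h \<beta> X) Y) = gibbs V E h \<beta> Y"
proof (cases "Y \<in> cliques V E")
  case True
  have "set_pmf (metropolis_step V E h \<beta> Y) \<subseteq> cliques V E"
    using assms True by (auto simp: metropolis_step_def Let_def split: if_splits)
  then have "(\<Sum>X\<in>cliques V E. pmf (metropolis_step V E h \<beta> Y) X) = 1"
    using finite_cliques[OF assms(1)] by (intro sum_pmf_eq_1)
  then show ?thesis
    by (simp add: gibbs_reversible[OF assms, of _ _ _ _ Y] flip: sum_distrib_left)
next
  case False
  then show ?thesis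
    by (simp add: gibbs_reversible[OF assms, of _ _ _ _ Y]) (simp add: gibbs_def)
qed

end

theory Submission
  imports Defs "HOL-Real_Asymp.Real_Asymp"
begin

text \<open>Write \<open>L = log n\<close>, \<open>D = \<gamma> (1 - \<alpha> - \<gamma>)\<close> and \<open>r = \<lceil>\<gamma> L\<rceil>\<close>. Since the intersection with the planted
  clique changes by at most one per step, the process has to visit a clique \<open>Y\<close> with
  \<open>|Y \<inter> PC| = r\<close>, and it suffices to bound \<open>Pr[X\<^sub>t = Y]\<close> for each such \<open>Y\<close>.

  By reversibility, \<open>Pr[X\<^sub>t = Y] / exp (\<beta> h\<^bsub>|Y|\<^esub>)\<close> is obtained from its initial value by running the
  process backwards from \<open>Y\<close>. To reach the small clique \<open>C\<close> from \<open>Y\<close>, the process has to descend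
  through all sizes below \<open>s = min |Y| ((1 - \<epsilon>) L)\<close>, where with high probability every clique of
  size \<open>i\<close> has at least \<open>n 2\<^bsup>-i\<^esup> / 8\<close> extensions by a vertex outside \<open>PC\<close>. Comparison with a birth-death
  chain on sizes then gives a bound on \<open>Pr[X\<^sub>t = Y]\<close> of order
  \<open>t exp (\<beta> (h\<^bsub>|Y|\<^esub> - h\<^sub>s)) 2\<^bsup>-s L + s s / 2 + o(L L)\<^esup>\<close> up to a factor that is small when \<open>C\<close> is small.

  Summing over the cliques \<open>Y\<close> of size \<open>q\<close>, whose number is bounded by a first moment estimate,
  \<open>\<beta> \<le> ln 2 \<gamma> L\<close> makes the exponent of \<open>2\<close> at most
  \<open>\<gamma>\<^sup>2 L\<^sup>2 / 2 + (\<gamma>\<^sup>2 / 2 - (1 - \<alpha>) \<gamma>) L\<^sup>2 = - D L\<^sup>2\<close> up to small errors. The first moment estimate also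
  excludes cliques with \<open>|Y \<inter> PC| = r\<close> and \<open>|Y| > 2.1 L\<close>, for which \<open>h\<close> is not controlled.\<close>

section \<open>The law of the Metropolis process\<close>

text \<open>The one-time marginal of the process. Unlike the path, it evolves by a one-step
  recursion, to which reversibility applies.\<close>

definition metropolis_law ::
    "'v set \<Rightarrow> 'v set set \<Rightarrow> (nat \<Rightarrow> real) \<Rightarrow> real \<Rightarrow> 'v set \<Rightarrow> nat \<Rightarrow> 'v set pmf" where
  "metropolis_law V E h \<beta> C t = map_pmf last (metropolis_path V E h \<beta> C t)"

lemma metropolis_law_0: "metropolis_law V E h \<beta> C 0 = return_pmf C"
  by (simp add: metropolis_law_def)

lemma metropolis_law_Suc:
  "metropolis_law V E h \<beta> C (Suc t) =
     bind_pmf (metropolis_law V E h \<beta> C t) (metropolis_step V E h \<beta>)"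
  by (simp add: metropolis_law_def map_bind_pmf bind_map_pmf bind_return_pmf')

lemma length_metropolis_path:
  "Xs \<in> set_pmf (metropolis_path V E h \<beta> C T) \<Longrightarrow> length Xs = Suc T"
  by (induction T arbitrary: Xs) auto

text \<open>Prolonging a path leaves its earlier entries alone, so a single path up to time
  \<open>T\<close> carries the marginals of all times \<open>t \<le> T\<close>. The union bound over
  times rests on this.\<close>

lemma map_nth_metropolis_path:
  "t \<le> T \<Longrightarrow> map_pmf (\<lambda>Xs. Xs ! t) (metropolis_path V E h \<beta> C T) = metropolis_law V E h \<beta> C t"
proof (induction T)
  case 0
  then show ?case by (simp add: metropolis_law_def)
next
  case (Suc T)
  show ?case
  proof (cases "t = Suc T")
    case True
    have "Xs ! t = last Xs" if "Xs \<in> set_pmf (metropolis_path V E h \<beta> C (Suc T))" for Xs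
      using length_metropolis_path[OF that] True by (subst last_conv_nth) auto
    then show ?thesis
      unfolding metropolis_law_def True by (intro map_pmf_cong) (auto simp: True)
  next
    case False
    with Suc.prems have t: "t \<le> T" by simp
    have "map_pmf (\<lambda>Xs. Xs ! t) (metropolis_path V E h \<beta> C (Suc T)) =
        bind_pmf (metropolis_path V E h \<beta> C T)
          (\<lambda>Xs. bind_pmf (metropolis_step V E h \<beta> (last Xs)) (\<lambda>Y. return_pmf ((Xs @ [Y]) ! t)))"
      by (simp add: map_bind_pmf)
    also have "\<dots> = bind_pmf (metropolis_path V E h \<beta> C T) (\<lambda>Xs. return_pmf (Xs ! t))"
      using t by (intro bind_pmf_cong) (auto simp: nth_append dest: length_metropolis_path)
    finally show ?thesis
      using Suc.IH[OF t] by (simp add: map_pmf_def)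
  qed
qed

lemma set_metropolis_step:
  assumes "finite V" "V \<noteq> {}" "X \<in> cliques V E" "Y \<in> set_pmf (metropolis_step V E h \<beta> X)"
  shows "Y \<in> cliques V E \<and> (Y = X \<or> (\<exists>v\<in>V. Y = sym_diff X {v}))"
  using assms by (auto simp: metropolis_step_def Let_def split: if_splits)

lemma set_metropolis_path:
  assumes "finite V" "V \<noteq> {}" "C \<in> cliques V E"
  shows "Xs \<in> set_pmf (metropolis_path V E h \<beta> C T) \<Longrightarrow>
    Xs ! 0 = C \<and> (\<forall>t\<le>T. Xs ! t \<in> cliques V E) \<and>
    (\<forall>t<T. Xs ! Suc t = Xs ! t \<or> (\<exists>v\<in>V. Xs ! Suc t = sym_diff (Xs ! t) {v}))"
proof (induction T arbitrary: Xs)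
  case 0
  then show ?case using assms by simp
next
  case (Suc T)
  then obtain Ys Y where Y: "Ys \<in> set_pmf (metropolis_path V E h \<beta> C T)" 
    "Y \<in> set_pmf (metropolis_step V E h \<beta> (last Ys))" "Xs = Ys @ [Y]"
    by auto
  have len: "length Ys = Suc T" using length_metropolis_path[OF Y(1)] .
  then have last: "last Ys = Ys ! T" by (subst last_conv_nth) auto
  note IH = Suc.IH[OF Y(1)]
  have "Y \<in> cliques V E \<and> (Y = Ys ! T \<or> (\<exists>v\<in>V. Y = sym_diff (Ys ! T) {v}))"
    using IH Y(2) unfolding last by (intro set_metropolis_step[OF assms(1,2)]) auto
  then show ?case
    using IH len by (auto simp: Y(3) nth_append le_Suc_eq less_Suc_eq)
qed

lemma set_metropolis_law:
  assumes "finite V" "V \<noteq> {}" "C \<in> cliques V E"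
  shows "set_pmf (metropolis_law V E h \<beta> C t) \<subseteq> cliques V E"
proof (induction t)
  case 0
  then show ?case using assms by (simp add: metropolis_law_0)
next
  case (Suc t)
  then show ?case
    using set_metropolis_step[OF assms(1,2)] by (fastforce simp: metropolis_law_Suc)
qed

section \<open>Reversibility and comparison with a birth-death chain on clique sizes\<close>

lemma metropolis_step_reversible:
  assumes "finite V" "V \<noteq> {}" "X \<in> cliques V E" "Y \<in> cliques V E"
  shows "exp (\<beta> * h (card X)) * pmf (metropolis_step V E h \<beta> X) Y =
         exp (\<beta> * h (card Y)) * pmf (metropolis_step V E h \<beta> Y) X"
proof -
  have "(\<Sum>D\<in>cliques V E. exp (\<beta> * h (card D))) > 0"
    using finite_cliques[OF assms(1)] assms(3) by (intro sum_pos) auto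
  then show ?thesis
    using gibbs_reversible[OF assms(1,2), of E h \<beta> X Y] assms(3,4) by (simp add: gibbs_def)
qed

text \<open>Backward equation: detailed balance turns the sum over predecessors of \<open>Y\<close>
  into an average over one step from \<open>Y\<close>. What is propagated is the density of the law
  relative to the unnormalised Gibbs weight.\<close>

lemma metropolis_density_Suc:
  assumes "finite V" "V \<noteq> {}" "C \<in> cliques V E" "Y \<in> cliques V E"
  shows "pmf (metropolis_law V E h \<beta> C (Suc t)) Y =
    exp (\<beta> * h (card Y)) * measure_pmf.expectation (metropolis_step V E h \<beta> Y)
      (\<lambda>X. pmf (metropolis_law V E h \<beta> C t) X / exp (\<beta> * h (card X)))"
proof -
  note fin = finite_cliques[OF assms(1)]
  have "pmf (metropolis_law V E h \<beta> C (Suc t)) Y =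
      (\<Sum>X\<in>cliques V E. pmf (metropolis_law V E h \<beta> C t) X * pmf (metropolis_step V E h \<beta> X) Y)"
    unfolding metropolis_law_Suc pmf_bind using set_metropolis_law[OF assms(1-3)]
    by (subst integral_measure_pmf[OF fin]) auto
  also have "\<dots> = (\<Sum>X\<in>cliques V E. exp (\<beta> * h (card Y)) * (pmf (metropolis_step V E h \<beta> Y) X *
      (pmf (metropolis_law V E h \<beta> C t) X / exp (\<beta> * h (card X)))))"
  proof (intro sum.cong refl)
    fix X assume "X \<in> cliques V E"
    from metropolis_step_reversible[OF assms(1,2) this assms(4), of \<beta> h]
    have "pmf (metropolis_step V E h \<beta> X) Y = 
      exp (\<beta> * h (card Y)) * pmf (metropolis_step V E h \<beta> Y) X / exp (\<beta> * h (card X))"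
      by (simp add: field_simps)
    then show "pmf (metropolis_law V E h \<beta> C t) X * pmf (metropolis_step V E h \<beta> X) Y =
      exp (\<beta> * h (card Y)) * (pmf (metropolis_step V E h \<beta> Y) X *
      (pmf (metropolis_law V E h \<beta> C t) X / exp (\<beta> * h (card X))))"
      by simp
  qed
  also have "\<dots> = exp (\<beta> * h (card Y)) * measure_pmf.expectation (metropolis_step V E h \<beta> Y)
      (\<lambda>X. pmf (metropolis_law V E h \<beta> C t) X / exp (\<beta> * h (card X)))"
    using set_metropolis_step[OF assms(1,2,4)]
    by (subst integral_measure_pmf[OF fin]) (auto simp: sum_distrib_left)
  finally show ?thesis .
qed

text \<open>On functions of the size, the graph enters only through the number of extensions: every
  removal yields a clique, so its rate depends on \<open>q\<close> alone. At \<open>q = 0\<close>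
  the truncated \<open>q - 1\<close> is harmless because of the factor \<open>q\<close>.\<close>

lemma expectation_metropolis_step_card:
  fixes f :: "nat \<Rightarrow> real"
  assumes "finite V" "V \<noteq> {}" "X \<in> cliques V E"
  defines "q \<equiv> card X"
  shows "measure_pmf.expectation (metropolis_step V E h \<beta> X) (\<lambda>Y. f (card Y)) =
    f q + (real q * min 1 (exp (\<beta> * (h (q - 1) - h q))) * (f (q - 1) - f q) +
      real (card {v\<in>V - X. insert v X \<in> cliques V E}) *
        min 1 (exp (\<beta> * (h (Suc q) - h q))) * (f (Suc q) - f q)) / real (card V)"
proof -
  have XV: "X \<subseteq> V" and finX: "finite X"
    using assms by (auto simp: cliques_def intro: finite_subset)
  define S where "S = (\<lambda>v. let C' = sym_diff X {v} in
       if C' \<in> cliques V E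
       then bind_pmf (bernoulli_pmf (min 1 (exp (\<beta> * (h (card C') - h (card X))))))
         (\<lambda>accept. return_pmf (if accept then C' else X))
       else return_pmf X)"
  define d where "d = min 1 (exp (\<beta> * (h (q - 1) - h q))) * (f (q - 1) - f q)"
  define a where "a = min 1 (exp (\<beta> * (h (Suc q) - h q))) * (f (Suc q) - f q)"
  have bern: "measure_pmf.expectation (bind_pmf (bernoulli_pmf p)
        (\<lambda>accept. return_pmf (if accept then C' else X))) (\<lambda>Y. f (card Y)) =
      f (card X) + p * (f (card C') - f (card X))" if "0 \<le> p" "p \<le> 1" for p C'
    using that by (simp add: map_pmf_def[symmetric] algebra_simps)
  have S_in: "measure_pmf.expectation (S v) (\<lambda>Y. f (card Y)) = f q + d" if "v \<in> X" for v
  proof -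
    have *: "sym_diff X {v} = X - {v}" using that by auto
    have "X - {v} \<in> cliques V E" using assms(3) by (auto simp: cliques_def)
    moreover have "card (X - {v}) = q - 1" using that finX by (simp add: q_def)
    ultimately show ?thesis
      unfolding S_def Let_def * using bern by (simp add: d_def q_def)
  qed
  have S_out: "measure_pmf.expectation (S v) (\<lambda>Y. f (card Y)) =
      f q + (if insert v X \<in> cliques V E then a else 0)" if "v \<in> V - X" for v
  proof -
    have *: "sym_diff X {v} = insert v X" using that by auto
    moreover have "card (insert v X) = Suc q" using that finX by (simp add: q_def)
    ultimately show ?thesis
      unfolding S_def Let_def * using bern by (simp add: a_def q_def)
  qed
  have "measure_pmf.expectation (metropolis_step V E h \<beta> X) (\<lambda>Y. f (card Y)) =
      (\<Sum>v\<in>V. measure_pmf.expectation (S v) (\<lambda>Y. f (card Y)) /\<^sub>R real (card V))"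
  proof -
    have "metropolis_step V E h \<beta> X = bind_pmf (pmf_of_set V) S"
      by (simp add: metropolis_step_def S_def)
    then show ?thesis
      using assms(1,2)
      by (simp only:) (rule pmf_expectation_bind_pmf_of_set, auto simp: S_def Let_def)
  qed
  also have "\<dots> = (\<Sum>v\<in>V. measure_pmf.expectation (S v) (\<lambda>Y. f (card Y))) / card V"
    by (simp add: sum_divide_distrib field_simps)
  also have "(\<Sum>v\<in>V. measure_pmf.expectation (S v) (\<lambda>Y. f (card Y))) =
      (\<Sum>v\<in>X. f q + d) + (\<Sum>v\<in>V - X. f q + (if insert v X \<in> cliques V E then a else 0))"
    using XV assms(1) S_in S_out by (subst sum.subset_diff[of X V]) auto
  also have "\<dots> = real (card X) * (f q + d) + (real (card (V - X)) * f q +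
      real (card {v\<in>V - X. insert v X \<in> cliques V E}) * a)"
    using assms(1) by (simp add: sum.distrib sum.If_cases Int_def conj_commute)
  also have "real (card (V - X)) = real (card V) - real q"
    using XV assms(1) finX by (simp add: card_Diff_subset card_mono of_nat_diff q_def)
  finally show ?thesis
    using assms(1,2) by (simp add: q_def[symmetric] a_def d_def field_simps)
qed

text \<open>The density at time \<open>t\<close> is dominated by a multiple of
  \<open>\<phi> (card X) + t * \<delta>\<close>, where \<open>\<phi>\<close> is nearly superharmonic
  for the backward step and vanishes from size \<open>s\<close> on. At \<open>Y\<close> only the
  accumulated error \<open>t * \<delta>\<close> is left, divided by a lower bound on
  \<open>\<phi>\<close> at the size of \<open>C\<close>.\<close>

lemma pmf_metropolis_law_le:
  fixes N :: "nat \<Rightarrow> real"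
  assumes V: "finite V" "V \<noteq> {}" and C: "C \<in> cliques V E" "card C < s"
    and N: "\<And>i. i < s \<Longrightarrow> 0 < N i"
    and ext: "\<And>X. X \<in> cliques V E \<Longrightarrow> card X < s \<Longrightarrow>
      N (card X) \<le> real (card {v\<in>V - X. insert v X \<in> cliques V E})"
    and Y: "Y \<in> cliques V E" "s \<le> card Y"
  shows "pmf (metropolis_law V E h \<beta> C t) Y \<le>
    real t * exp (\<beta> * (h (card Y) - h s)) * (\<Prod>i = card C..<s. real (Suc i) / N i)"
proof -
  define n where "n = real (card V)"
  have n: "n > 0" using V by (simp add: n_def card_gt_0_iff)
  define e where "e = (\<lambda>i. exp (\<beta> * h i))"
  have e: "e i > 0" for i by (simp add: e_def)
  have exp_eq: "exp (\<beta> * h i) = e i" for i by (simp add: e_def)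
  \<comment> \<open>Both acceptance probabilities between sizes \<open>i\<close> and
    \<open>i + 1\<close> have numerator \<open>m i\<close>, over \<open>e i\<close> upwards and over
    \<open>e (Suc i)\<close> downwards.\<close>
  define m where "m = (\<lambda>i. min (e i) (e (Suc i)))"
  have m: "m i > 0" for i by (simp add: m_def e)
  \<comment> \<open>\<open>1 / R i\<close> would be the number of cliques of size \<open>i\<close>
    if each clique of size \<open>j\<close> had exactly \<open>N j\<close> extensions. Hence
    \<open>g i\<close> below is, up to the factor \<open>n\<close>, the resistance of the link
    between sizes \<open>i\<close> and \<open>i + 1\<close>.\<close>
  define R where "R = (\<lambda>i. \<Prod>j<i. real (Suc j) / N j)"
  have R: "R i > 0" if "i \<le> s" for i
    unfolding R_def using that N by (intro prod_pos) auto
  define g where "g = (\<lambda>i. R i / (N i * m i))"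
  have g_pos: "g i > 0" if "i < s" for i
    unfolding g_def using that R N m by auto
  \<comment> \<open>\<open>\<phi>\<close> is the scale function of the birth-death chain on the clique sizes that has exactly \<open>N q\<close>
    extensions at size \<open>q\<close>, made constant beyond \<open>s\<close>. It decreases, so further extensions only help,
    and it is a supermartingale up to the error \<open>\<delta>\<close> made at size \<open>s\<close>.\<close>
  define \<phi> where "\<phi> = (\<lambda>q. \<Sum>i = q..<s. g i)"
  define q0 where "q0 = card C"
  have q0: "q0 < s" using C by (simp add: q0_def)
  have \<phi>_nonneg: "\<phi> q \<ge> 0" for q
    unfolding \<phi>_def by (intro sum_nonneg) (auto intro: less_imp_le g_pos)
  have \<phi>_q0: "\<phi> q0 \<ge> g q0"
    unfolding \<phi>_def using q0 g_pos by (intro member_le_sum) (auto intro: less_imp_le)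
  have \<phi>_pos: "\<phi> q0 > 0" using \<phi>_q0 g_pos[OF q0] by linarith
  have \<phi>_up: "\<phi> (Suc q) - \<phi> q = (if q < s then - g q else 0)" for q
    unfolding \<phi>_def by (auto simp: sum.atLeast_Suc_lessThan)
  then have \<phi>_down: "\<phi> q - \<phi> (Suc q) = (if q < s then g q else 0)" for q
    by (smt (verit))
  have a_eq: "min 1 (exp (\<beta> * (h (Suc q) - h q))) = m q / e q" for q
    by (auto simp: m_def e_def min_def right_diff_distrib exp_diff field_simps)
  have d_eq: "min 1 (exp (\<beta> * (h q - h (Suc q)))) = m q / e (Suc q)" for q
    by (auto simp: m_def e_def min_def right_diff_distrib exp_diff field_simps)
  define \<delta> where "\<delta> = R s / (e s * n)"
  have \<delta>: "\<delta> > 0" using R e n by (simp add: \<delta>_def)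
  \<comment> \<open>The contribution \<open>R q / e q\<close> of removals is exactly offset by that
    of \<open>N q\<close> additions at a size \<open>q < s\<close>. At \<open>q = s\<close> nothing
    offsets it, and after division by \<open>n\<close> it becomes \<delta>.\<close>
  have down: "real q * min 1 (exp (\<beta> * (h (q - 1) - h q))) * (\<phi> (q - 1) - \<phi> q) =
      (if q = 0 \<or> q > s then 0 else R q / e q)" for q
  proof (cases q)
    case (Suc i)
    have "real (Suc i) * (m i / e (Suc i)) * g i = R (Suc i) / e (Suc i)" if "i < s"
      using m[of i] N[OF that] e[of "Suc i"] by (simp add: g_def R_def field_simps)
    then show ?thesis
      using \<phi>_up[of i] \<phi>_down[of i] unfolding Suc by (auto simp: d_eq simp del: of_nat_Suc)
  qed simp
  have drift: "measure_pmf.expectation (metropolis_step V E h \<beta> X) (\<lambda>Y. \<phi> (card Y)) \<le>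
      \<phi> (card X) + \<delta>" if X: "X \<in> cliques V E" for X
  proof -
    define q where "q = card X"
    define A where "A = real (card {v\<in>V - X. insert v X \<in> cliques V E})"
    have eq: "measure_pmf.expectation (metropolis_step V E h \<beta> X) (\<lambda>Y. \<phi> (card Y)) =
      \<phi> q + ((if q = 0 \<or> q > s then 0 else R q / e q) + A * (m q / e q) * (if q < s then - g q else 0)) / n"
      unfolding expectation_metropolis_step_card[OF V X] q_def[symmetric] A_def[symmetric]
        down a_eq \<phi>_up n_def[symmetric] ..
    show ?thesis
    proof (cases "q < s")
      case True
      have "N q * ((m q / e q) * g q) = R q / e q"
        using m[of q] N[OF True] e[of q] by (simp add: g_def field_simps)
      moreover have "A * ((m q / e q) * g q) \<ge> N q * ((m q / e q) * g q)"
        using ext[OF X] True m[of q] e[of q] g_pos[OF True]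
        by (intro mult_right_mono) (auto simp: A_def q_def)
      moreover have "A * (m q / e q) * (- g q) = - (A * ((m q / e q) * g q))"
        by simp
      moreover have "0 \<le> R q / e q"
        using R[of q] True e[of q] by simp
      ultimately have "(if q = 0 \<or> q > s then 0 else R q / e q) + A * (m q / e q) * (- g q) \<le> 0"
        by auto
      then have "((if q = 0 \<or> q > s then 0 else R q / e q) + A * (m q / e q) * (- g q)) / n \<le> 0"
        using n by (rule divide_nonpos_pos)
      then show ?thesis
        unfolding eq using True \<delta> by (simp add: q_def)
    next
      case False
      then show ?thesis
        unfolding eq using \<delta> by (auto simp: \<delta>_def q_def)
    qed
  qed
  \<comment> \<open>The factor \<open>\<phi> q0 * e q0\<close> makes the bound an equality at
    \<open>X = C\<close>, \<open>t = 0\<close>; each further step costs one \<delta> by the drift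
    estimate.\<close>
  have main: "X \<in> cliques V E \<Longrightarrow> pmf (metropolis_law V E h \<beta> C t) X \<le>
     e (card X) * ((\<phi> (card X) + real t * \<delta>) / (\<phi> q0 * e q0))" for X t
  proof (induction t arbitrary: X)
    case 0
    show ?case
      using \<phi>_pos e[of q0] e[of "card X"] \<phi>_nonneg[of "card X"]
      by (auto simp: metropolis_law_0 q0_def indicator_def)
  next
    case (Suc t)
    have fin: "finite (set_pmf (metropolis_step V E h \<beta> X))"
      using set_metropolis_step[OF V Suc.prems] finite_cliques[OF V(1), of E]
      by (meson finite_subset subsetI)
    have "measure_pmf.expectation (metropolis_step V E h \<beta> X)
        (\<lambda>Z. pmf (metropolis_law V E h \<beta> C t) Z / e (card Z)) \<le>
      measure_pmf.expectation (metropolis_step V E h \<beta> X)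
        (\<lambda>Z. (\<phi> (card Z) + real t * \<delta>) / (\<phi> q0 * e q0))"
    proof (rule integral_mono_AE)
      show "AE Z in measure_pmf (metropolis_step V E h \<beta> X).
          pmf (metropolis_law V E h \<beta> C t) Z / e (card Z) \<le> (\<phi> (card Z) + real t * \<delta>) / (\<phi> q0 * e q0)"
        using set_metropolis_step[OF V Suc.prems] Suc.IH e 
        by (auto simp: AE_measure_pmf_iff divide_le_eq mult.commute)
    qed (auto intro: integrable_measure_pmf_finite fin)
    also have "\<dots> = (measure_pmf.expectation (metropolis_step V E h \<beta> X) (\<lambda>Z. \<phi> (card Z)) 
        + real t * \<delta>) / (\<phi> q0 * e q0)"
      by (simp add: Bochner_Integration.integral_add integrable_measure_pmf_finite[OF fin])
    also have "\<dots> \<le> (\<phi> (card X) + \<delta> + real t * \<delta>) / (\<phi> q0 * e q0)"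
      using drift[OF Suc.prems] \<phi>_pos e[of q0] by (intro divide_right_mono add_right_mono) auto
    also have "\<phi> (card X) + \<delta> + real t * \<delta> = \<phi> (card X) + real (Suc t) * \<delta>"
      by (simp add: algebra_simps)
    finally show ?case
      unfolding metropolis_density_Suc[OF V C(1) Suc.prems] exp_eq
      using e[of "card X"] by (intro mult_left_mono) auto
  qed
  have Nq0: "N q0 \<le> n"
  proof -
    have "N q0 \<le> real (card {v\<in>V - C. insert v C \<in> cliques V E})"
      using ext[OF C] by (simp add: q0_def)
    also have "\<dots> \<le> n"
      unfolding n_def using V by (intro of_nat_mono card_mono) auto
    finally show ?thesis .
  qed
  \<comment> \<open>Only the first summand of \<open>\<phi> q0\<close> is kept. Replacing
    \<open>N q0 * m q0\<close> by \<open>n * e q0\<close> makes \<open>n\<close> and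
    \<open>e q0\<close> cancel in the final quotient.\<close>
  have "N q0 * m q0 \<le> n * e q0"
    using Nq0 m[of q0] N[OF q0] n e[of q0] by (intro mult_mono) (auto simp: m_def)
  then have "R q0 / (n * e q0) \<le> g q0"
    unfolding g_def using R[of q0] q0 N[OF q0] m[of q0] n e[of q0] by (intro divide_left_mono) auto
  then have \<phi>': "R q0 / (n * e q0) \<le> \<phi> q0" using \<phi>_q0 by linarith
  have "\<phi> (card Y) = 0" using Y by (simp add: \<phi>_def)
  then have "pmf (metropolis_law V E h \<beta> C t) Y \<le>
      e (card Y) * real t * \<delta> / (\<phi> q0 * e q0)"
    using main[OF Y(1), of t] by simp
  also have "\<dots> \<le> e (card Y) * real t * \<delta> / (R q0 / (n * e q0) * e q0)"
    using \<phi>' \<phi>_pos e n R[of q0] q0 \<delta>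
    by (intro divide_left_mono mult_right_mono mult_nonneg_nonneg mult_pos_pos) (auto intro: less_imp_le)
  also have "\<dots> = real t * (e (card Y) / e s) * (R s / R q0)"
    using e[of q0] e[of s] n R[of q0] q0 by (simp add: \<delta>_def field_simps)
  also have "e (card Y) / e s = exp (\<beta> * (h (card Y) - h s))"
    by (simp add: e_def right_diff_distrib exp_diff)
  also have "R s / R q0 = (\<Prod>i = q0..<s. real (Suc i) / N i)"
  proof -
    have "R s = R q0 * (\<Prod>i = q0..<s. real (Suc i) / N i)"
      unfolding R_def lessThan_atLeast0 using q0 by (subst prod.atLeastLessThan_concat) auto
    then show ?thesis using R[of q0] q0 by simp
  qed
  finally show ?thesis by (simp add: q0_def)
qed

section \<open>Crossing a level of the intersection with the planted clique\<close>

lemma card_inter_sym_diff_le: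
  assumes "finite (X \<inter> K)"
  shows "card (sym_diff X {v} \<inter> K) \<le> Suc (card (X \<inter> K))"
proof -
  have "card (sym_diff X {v} \<inter> K) \<le> card (insert v (X \<inter> K))"
    using assms by (intro card_mono) auto
  also have "\<dots> \<le> Suc (card (X \<inter> K))"
    using assms by (simp add: card_insert_if)
  finally show ?thesis .
qed

text \<open>At the first time the intersection has size at least \<open>r\<close>, it has size
  exactly \<open>r\<close>, because it starts below and grows by at most one per step. A union bound
  over times and over the cliques on this level follows.\<close>

lemma prob_metropolis_path_crossing:
  assumes V: "finite V" "V \<noteq> {}" and C: "C \<in> cliques V E" "card (C \<inter> K) < r"
  shows "measure_pmf.prob (metropolis_path V E h \<beta> C T) {Xs. \<exists>t\<le>T. r \<le> card (Xs ! t \<inter> K)} \<le>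
    (\<Sum>t\<le>T. \<Sum>Y | Y \<in> cliques V E \<and> card (Y \<inter> K) = r. pmf (metropolis_law V E h \<beta> C t) Y)"
proof -
  define B where "B = {Y \<in> cliques V E. card (Y \<inter> K) = r}"
  define p where "p = metropolis_path V E h \<beta> C T"
  have finB: "finite B" unfolding B_def using finite_cliques[OF V(1)] by simp
  have "measure_pmf.prob p {Xs. \<exists>t\<le>T. r \<le> card (Xs ! t \<inter> K)} \<le>
      measure_pmf.prob p (\<Union>t\<in>{..T}. {Xs. Xs ! t \<in> B})"
  proof (rule measure_pmf.finite_measure_mono_AE)
    have "\<exists>t\<le>T. Xs ! t \<in> B" if Xs: "Xs \<in> set_pmf p" and t: "t \<le> T" "r \<le> card (Xs ! t \<inter> K)" for Xs t
    proof -
      note path = set_metropolis_path[OF V C(1) Xs[unfolded p_def]]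
      define u where "u = (LEAST u. r \<le> card (Xs ! u \<inter> K))"
      have u: "r \<le> card (Xs ! u \<inter> K)" "u \<le> t"
        unfolding u_def using t(2) by (auto intro: LeastI Least_le)
      have "u \<noteq> 0" using u(1) C(2) path by (intro notI) simp
      then obtain u' where u': "u = Suc u'" by (cases u) auto
      have "\<not> r \<le> card (Xs ! u' \<inter> K)"
        using not_less_Least[of u' "\<lambda>u. r \<le> card (Xs ! u \<inter> K)"] u' by (simp add: u_def)
      moreover have "card (Xs ! u \<inter> K) \<le> Suc (card (Xs ! u' \<inter> K))"
      proof -
        have "Xs ! u' \<in> cliques V E" using path u u' t by auto
        then have "finite (Xs ! u' \<inter> K)"
          using V(1) by (auto simp: cliques_def intro: finite_subset)
        note le = card_inter_sym_diff_le[OF this]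
        from path u u' t have "Xs ! u = Xs ! u' \<or> (\<exists>v\<in>V. Xs ! u = sym_diff (Xs ! u') {v})"
          by auto
        then show ?thesis using le by auto
      qed
      ultimately have "card (Xs ! u \<inter> K) = r" using u by simp
      moreover have "Xs ! u \<in> cliques V E" using path u t by auto
      ultimately show ?thesis using u t by (intro exI[of _ u]) (simp add: B_def)
    qed
    then show "AE Xs in measure_pmf p. Xs \<in> {Xs. \<exists>t\<le>T. r \<le> card (Xs ! t \<inter> K)} \<longrightarrow>
        Xs \<in> (\<Union>t\<in>{..T}. {Xs. Xs ! t \<in> B})"
      by (auto simp: AE_measure_pmf_iff)
  qed auto
  also have "\<dots> \<le> (\<Sum>t\<le>T. measure_pmf.prob p {Xs. Xs ! t \<in> B})"
    by (intro measure_pmf.finite_measure_subadditive_finite) auto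
  also have "\<dots> = (\<Sum>t\<le>T. \<Sum>Y\<in>B. pmf (metropolis_law V E h \<beta> C t) Y)"
  proof (intro sum.cong refl)
    fix t assume "t \<in> {..T}"
    then have "metropolis_law V E h \<beta> C t = map_pmf (\<lambda>Xs. Xs ! t) p"
      by (simp add: p_def map_nth_metropolis_path)
    then have "measure_pmf.prob p {Xs. Xs ! t \<in> B} = measure_pmf.prob (metropolis_law V E h \<beta> C t) B"
      by (simp add: vimage_def)
    then show "measure_pmf.prob p {Xs. Xs ! t \<in> B} = (\<Sum>Y\<in>B. pmf (metropolis_law V E h \<beta> C t) Y)"
      using finB by (simp add: measure_measure_pmf_finite)
  qed
  finally show ?thesis by (simp add: B_def p_def)
qed

text \<open>The pointwise bound is applied with the barrier at \<open>min (card Y) s\<close>, since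
  extensions are guaranteed only below \<open>s\<close> and the barrier may not exceed the size of
  \<open>Y\<close>. The factor \<open>T + 1\<close> counts the times, and \<open>T\<close> comes
  from the factor \<open>t\<close> of the pointwise bound.\<close>

lemma prob_metropolis_path_crossing_le:
  fixes N :: "nat \<Rightarrow> real"
  assumes V: "finite V" "V \<noteq> {}" and C: "C \<in> cliques V E" "card C < r" "card C < s"
    and N: "\<And>i. i < s \<Longrightarrow> 0 < N i"
    and ext: "\<And>X. X \<in> cliques V E \<Longrightarrow> card X < s \<Longrightarrow>
      N (card X) \<le> real (card {v\<in>V - X. insert v X \<in> cliques V E})"
  shows "measure_pmf.prob (metropolis_path V E h \<beta> C T) {Xs. \<exists>t\<le>T. r \<le> card (Xs ! t \<inter> K)} \<le>
    (real T + 1) * real T * (\<Sum>q = r..card V.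
      real (card {Y \<in> cliques V E. card Y = q \<and> card (Y \<inter> K) = r}) *
      (exp (\<beta> * (h q - h (min q s))) * (\<Prod>i = card C..<min q s. real (Suc i) / N i)))"
proof -
  define F where "F = (\<lambda>q. exp (\<beta> * (h q - h (min q s))) * (\<Prod>i = card C..<min q s. real (Suc i) / N i))"
  define B where "B = {Y \<in> cliques V E. card (Y \<inter> K) = r}"
  have finB: "finite B" unfolding B_def using finite_cliques[OF V(1)] by simp
  have F: "F q \<ge> 0" for q
    unfolding F_def using N by (intro mult_nonneg_nonneg prod_nonneg) (auto intro: less_imp_le)
  have finC: "X \<in> cliques V E \<Longrightarrow> finite X" for X
    using V(1) by (auto simp: cliques_def intro: finite_subset)
  have range: "card Y \<in> {r..card V}" if "Y \<in> B" for Y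
    using that V(1) finC card_mono[of Y "Y \<inter> K"] by (auto simp: B_def cliques_def intro: card_mono)
  have "card (C \<inter> K) \<le> card C" using finC[OF C(1)] by (intro card_mono) auto
  then have "card (C \<inter> K) < r" using C(2) by simp
  from prob_metropolis_path_crossing[OF V C(1) this, of h \<beta> T]
  have "measure_pmf.prob (metropolis_path V E h \<beta> C T) {Xs. \<exists>t\<le>T. r \<le> card (Xs ! t \<inter> K)} \<le>
    (\<Sum>t\<le>T. \<Sum>Y\<in>B. pmf (metropolis_law V E h \<beta> C t) Y)" by (simp add: B_def)
  also have "\<dots> \<le> (\<Sum>t\<le>T. \<Sum>Y\<in>B. real T * F (card Y))"
  proof (intro sum_mono)
    fix t Y assume t: "t \<in> {..T}" and Y: "Y \<in> B"
    have "pmf (metropolis_law V E h \<beta> C t) Y \<le> real t * exp (\<beta> * (h (card Y) - h (min (card Y) s))) *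
        (\<Prod>i = card C..<min (card Y) s. real (Suc i) / N i)"
      using Y range[OF Y] C N ext by (intro pmf_metropolis_law_le V) (auto simp: B_def)
    also have "\<dots> = real t * F (card Y)" by (simp add: F_def)
    also have "\<dots> \<le> real T * F (card Y)" using t F by (intro mult_right_mono) auto
    finally show "pmf (metropolis_law V E h \<beta> C t) Y \<le> real T * F (card Y)" .
  qed
  also have "\<dots> = (real T + 1) * real T * (\<Sum>Y\<in>B. F (card Y))"
    by (simp add: sum_distrib_left[symmetric] algebra_simps)
  also have "(\<Sum>Y\<in>B. F (card Y)) = (\<Sum>q = r..card V. \<Sum>Y\<in>{Y. Y \<in> B \<and> card Y = q}. F (card Y))"
    using finB range by (intro sum.group[symmetric]) auto
  also have "\<dots> = (\<Sum>q = r..card V. real (card {Y \<in> cliques V E. card Y = q \<and> card (Y \<inter> K) = r}) * F q)"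
    by (intro sum.cong refl) (auto simp: B_def conj_ac)
  finally show ?thesis by (simp add: F_def)
qed

section \<open>Cliques of the planted random graph\<close>

lemma finite_vertex_pairs: "finite V \<Longrightarrow> finite (vertex_pairs V)"
  by (rule finite_subset[of _ "Pow V"]) (auto simp: vertex_pairs_def)

lemma card_vertex_pairs: "finite V \<Longrightarrow> card (vertex_pairs V) = card V choose 2"
  unfolding vertex_pairs_def by (rule n_subsets)

lemma vertex_pairs_Int: "vertex_pairs (A \<inter> B) = vertex_pairs A \<inter> vertex_pairs B"
  by (auto simp: vertex_pairs_def)

lemma vertex_pairs_mono: "A \<subseteq> B \<Longrightarrow> vertex_pairs A \<subseteq> vertex_pairs B"
  by (auto simp: vertex_pairs_def)

lemma cliques_iff_vertex_pairs: "C \<in> cliques V E \<longleftrightarrow> C \<subseteq> V \<and> vertex_pairs C \<subseteq> E"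
proof
  assume "C \<in> cliques V E"
  then show "C \<subseteq> V \<and> vertex_pairs C \<subseteq> E"
    by (auto simp: cliques_def vertex_pairs_def card_2_iff)
next
  assume *: "C \<subseteq> V \<and> vertex_pairs C \<subseteq> E"
  have "{u, v} \<in> vertex_pairs C" if "u \<in> C" "v \<in> C" "u \<noteq> v" for u v
    using that by (simp add: vertex_pairs_def)
  with * show "C \<in> cliques V E" by (auto simp: cliques_def)
qed

section \<open>Independence and lower tails for uniform random edge sets\<close>

lemma random_graph_half: "finite V \<Longrightarrow> random_graph V (1 / 2) = pmf_of_set (Pow (vertex_pairs V))"
  unfolding random_graph_def
  by (rule pmf_of_set_Pow_conv_bernoulli) (rule finite_vertex_pairs)

lemma card_supersets:
  assumes "finite A" "S \<subseteq> A"
  shows "card {F. S \<subseteq> F \<and> F \<subseteq> A} = 2 ^ (card A - card S)"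
proof -
  have "bij_betw (\<lambda>F. F - S) {F. S \<subseteq> F \<and> F \<subseteq> A} (Pow (A - S))"
    by (rule bij_betw_byWitness[of _ "\<lambda>F. F \<union> S"]) (use assms in auto)
  then have "card {F. S \<subseteq> F \<and> F \<subseteq> A} = card (Pow (A - S))"
    by (rule bij_betw_same_card)
  also have "\<dots> = 2 ^ (card A - card S)"
    using assms by (simp add: card_Pow card_Diff_subset finite_subset)
  finally show ?thesis .
qed

lemma prob_supersets:
  assumes "finite A" "S \<subseteq> A"
  shows "measure_pmf.prob (pmf_of_set (Pow A)) {F. S \<subseteq> F} = (1 / 2) ^ card S"
proof -
  have "Pow A \<inter> {F. S \<subseteq> F} = {F. S \<subseteq> F \<and> F \<subseteq> A}" by auto
  then have "measure_pmf.prob (pmf_of_set (Pow A)) {F. S \<subseteq> F} = 2 ^ (card A - card S) / 2 ^ card A"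
    using assms by (subst measure_pmf_of_set) (auto simp: card_supersets card_Pow)
  also have "\<dots> = (1 / 2) ^ card S"
    using card_mono[OF assms] by (simp add: power_diff power_divide)
  finally show ?thesis .
qed

lemma sum_Pow_Un_disjoint:
  fixes f g :: "'a set \<Rightarrow> real"
  assumes "A \<inter> B = {}"
  shows "(\<Sum>F\<in>Pow (A \<union> B). f (F \<inter> A) * g (F \<inter> B)) = (\<Sum>F\<in>Pow A. f F) * (\<Sum>F\<in>Pow B. g F)"
proof -
  have "(\<Sum>F\<in>Pow (A \<union> B). f (F \<inter> A) * g (F \<inter> B)) = (\<Sum>(F, F')\<in>Pow A \<times> Pow B. f F * g F')"
    by (rule sum.reindex_bij_witness[of _ "\<lambda>(F, F'). F \<union> F'" "\<lambda>F. (F \<inter> A, F \<inter> B)"])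
       (use assms in \<open>auto intro!: arg_cong2[of _ _ _ _ "(*)"] arg_cong[of _ _ f] arg_cong[of _ _ g]\<close>)
  then show ?thesis
    by (simp add: sum_product sum.cartesian_product)
qed

lemma expectation_pmf_of_set_Pow:
  fixes f :: "'a set \<Rightarrow> real"
  shows "finite A \<Longrightarrow> measure_pmf.expectation (pmf_of_set (Pow A)) f = sum f (Pow A) / card (Pow A)"
  by (rule integral_pmf_of_set) auto

text \<open>Independence in counting form: the traces of a uniform random subset on disjoint blocks
  are independent. The induction splits off one block and passes from \<open>A\<close> to
  \<open>A - S i\<close>.\<close>

lemma expectation_prod_Pow:
  fixes f :: "'i \<Rightarrow> 'a set \<Rightarrow> real"
  assumes "finite I" "finite A" "disjoint_family_on S I" "\<And>i. i \<in> I \<Longrightarrow> S i \<subseteq> A"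
  shows "measure_pmf.expectation (pmf_of_set (Pow A)) (\<lambda>F. \<Prod>i\<in>I. f i (F \<inter> S i)) =
    (\<Prod>i\<in>I. measure_pmf.expectation (pmf_of_set (Pow (S i))) (f i))"
  using assms
proof (induction I arbitrary: A rule: finite_induct)
  case empty
  then show ?case by simp
next
  case (insert i I)
  define B where "B = A - S i"
  have A: "A = S i \<union> B" "S i \<inter> B = {}" and fin: "finite (S i)" "finite B"
    using insert.prems finite_subset[of "S i" A] by (auto simp: B_def)
  have sub: "S j \<subseteq> B" if "j \<in> I" for j
    using insert.prems(2,3) insert.hyps(2) that 
    by (force simp: B_def disjoint_family_on_def)
  have "(\<Sum>F\<in>Pow A. \<Prod>j\<in>insert i I. f j (F \<inter> S j)) =
      (\<Sum>F\<in>Pow (S i \<union> B). f i (F \<inter> S i) * (\<Prod>j\<in>I. f j (F \<inter> B \<inter> S j)))"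
  proof -
    have "F \<inter> B \<inter> S j = F \<inter> S j" if "j \<in> I" for F j using sub[OF that] by auto
    then show ?thesis using insert.hyps unfolding A(1)[symmetric] by simp
  qed
  also have "\<dots> = (\<Sum>F\<in>Pow (S i). f i F) * (\<Sum>F\<in>Pow B. \<Prod>j\<in>I. f j (F \<inter> S j))"
    by (rule sum_Pow_Un_disjoint[OF A(2)])
  finally have *: "(\<Sum>F\<in>Pow A. \<Prod>j\<in>insert i I. f j (F \<inter> S j)) =
    (\<Sum>F\<in>Pow (S i). f i F) * (\<Sum>F\<in>Pow B. \<Prod>j\<in>I. f j (F \<inter> S j))" .
  have cA: "card (Pow A) = card (Pow (S i)) * card (Pow B)"
    using fin A by (simp add: card_Pow card_Un_disjoint power_add)
  have IH: "measure_pmf.expectation (pmf_of_set (Pow B)) (\<lambda>F. \<Prod>i\<in>I. f i (F \<inter> S i)) =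
    (\<Prod>i\<in>I. measure_pmf.expectation (pmf_of_set (Pow (S i))) (f i))"
    using insert.prems(2) fin sub by (intro insert.IH) (auto simp: disjoint_family_on_def)
  show ?case
    using insert.hyps fin insert.prems(1) *
    by (simp add: IH[symmetric] expectation_pmf_of_set_Pow cA)
qed

text \<open>For distinct \<open>v\<close> the stars from \<open>v\<close> to \<open>U\<close> are
  disjoint sets of pairs, so the events that \<open>v\<close> is adjacent to all of \<open>U\<close>
  are independent, each of probability \<open>p\<close>. The threshold is a quarter of the mean
  number of such \<open>v\<close>.\<close>

lemma prob_common_neighbours_less:
  fixes V U R :: "'v set" and p :: real
  assumes "finite V" "U \<subseteq> V" "R \<subseteq> V" "U \<inter> R = {}"
  defines "p \<equiv> (1 / 2) ^ card U"
  shows "measure_pmf.prob (random_graph V (1 / 2))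
      {E. real (card {v\<in>R. \<forall>u\<in>U. {u, v} \<in> E}) < real (card R) * p / 4} \<le> exp (- real (card R) * p / 4)"
proof -
  define A where "A = vertex_pairs V"
  have finA: "finite A" using assms by (simp add: A_def finite_vertex_pairs)
  have finR: "finite R" and finU: "finite U" using assms by (auto intro: finite_subset)
  define S where "S = (\<lambda>v. (\<lambda>u. {u, v}) ` U)"
  have inj: "inj_on (\<lambda>u. {u, v}) U" for v by (auto simp: inj_on_def doubleton_eq_iff)
  have cS: "card (S v) = card U" for v unfolding S_def by (rule card_image[OF inj])
  have SA: "S v \<subseteq> A" if "v \<in> R" for v
  proof -
    have "card {u, v} = 2" if "u \<in> U" for u
      using that \<open>v \<in> R\<close> assms(4) by (subst card_2_iff) blast
    then show ?thesis
      using that assms(2,3) by (auto simp: S_def A_def vertex_pairs_def)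
  qed
  have finS: "finite (S v)" for v using finU by (simp add: S_def)
  have disj: "disjoint_family_on S R"
    using assms(4) by (auto simp: disjoint_family_on_def S_def doubleton_eq_iff)
  define Y where "Y = (\<lambda>E. card {v\<in>R. S v \<subseteq> E})"
  \<comment> \<open>One factor \<open>1 / 2\<close> for each counted \<open>v\<close>: the product
    over \<open>R\<close> is \<open>(1 / 2) ^ Y E\<close>, and each factor has mean
    \<open>1 - p / 2\<close>.\<close>
  define f where "f = (\<lambda>v F. if S v \<subseteq> F then 1 / 2 else 1 :: real)"
  define M where "M = pmf_of_set (Pow A)"
  have M: "random_graph V (1 / 2) = M" using assms by (simp add: M_def A_def random_graph_half)
  have finM: "finite (set_pmf M)" unfolding M_def using finA by (subst set_pmf_of_set) auto
  have fE: "(\<Prod>v\<in>R. f v (E \<inter> S v)) = (1 / 2) ^ Y E" for E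
  proof -
    have "f v (E \<inter> S v) = (if S v \<subseteq> E then 1 / 2 else 1)" for v
      by (auto simp: f_def)
    then show ?thesis using finR by (simp add: Y_def prod.If_cases Int_def)
  qed
  have "measure_pmf.expectation (pmf_of_set (Pow (S v))) (f v) = 1 - p / 2" if "v \<in> R" for v
  proof -
    have "f v = (\<lambda>F. 1 - indicator {F. S v \<subseteq> F} F / 2)"
      by (auto simp: f_def indicator_def)
    then have "measure_pmf.expectation (pmf_of_set (Pow (S v))) (f v) =
        1 - measure_pmf.prob (pmf_of_set (Pow (S v))) {F. S v \<subseteq> F} / 2"
      using finS by (simp add: measure_pmf.emeasure_eq_measure)
    then show ?thesis
      using prob_supersets[of "S v" "S v"] finS by (simp add: p_def cS)
  qed
  then have "measure_pmf.expectation M (\<lambda>E. (1 / 2) ^ Y E) = (1 - p / 2) ^ card R"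
    using expectation_prod_Pow[OF finR finA disj SA, of f] by (simp add: fE M_def)
  also have "\<dots> \<le> exp (- p / 2) ^ card R"
  proof (rule power_mono)
    have "p \<le> 1" by (simp add: p_def power_le_one)
    then show "0 \<le> 1 - p / 2" by simp
  qed (use exp_ge_add_one_self[of "- p / 2"] in simp)
  also have "\<dots> = exp (- real (card R) * p / 2)"
    by (simp add: exp_of_nat_mult[symmetric])
  finally have expY: "measure_pmf.expectation M (\<lambda>E. (1 / 2) ^ Y E) \<le> exp (- real (card R) * p / 2)" .
  \<comment> \<open>The moment bound reads \<open>exp (- 2 * y)\<close>, and the Markov factor is
    \<open>exp y\<close> since \<open>exp (- 1) \<le> 1 / 2\<close>; together they give
    \<open>exp (- y)\<close>.\<close>
  define y where "y = real (card R) * p / 4"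
  have y: "y \<ge> 0" by (simp add: y_def p_def)
  \<comment> \<open>The exponential moment method with base \<open>1 / 2\<close>; Hoeffding's inequality is too weak here, because
    \<open>p\<close> may be much smaller than \<open>card R powr (- 1 / 2)\<close>.\<close>
  have "measure_pmf.prob M {E. real (Y E) < y} = measure_pmf.expectation M (indicator {E. real (Y E) < y})"
    by simp
  also have "\<dots> \<le> measure_pmf.expectation M (\<lambda>E. exp y * (1 / 2) ^ Y E)"
  proof (intro integral_mono integrable_measure_pmf_finite)
    show "finite (set_pmf M)" using finM .
    then show "finite (set_pmf M)" .
    fix E
    have "exp (- real (Y E)) \<le> (1 / 2) ^ Y E"
    proof -
      have "exp (- 1) \<le> (1 / 2 :: real)"
        using exp_ge_add_one_self[of "1 :: real"] by (simp add: exp_minus field_simps)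
      then have "exp (- 1 :: real) ^ Y E \<le> (1 / 2) ^ Y E" by (intro power_mono) auto
      then show ?thesis by (simp add: exp_of_nat_mult[symmetric])
    qed
    then have "exp (y - real (Y E)) \<le> exp y * (1 / 2) ^ Y E"
      unfolding diff_conv_add_uminus exp_add by (intro mult_left_mono) auto
    moreover have "1 \<le> exp (y - real (Y E))" if "real (Y E) < y" using that by simp
    ultimately show "indicator {E. real (Y E) < y} E \<le> exp y * (1 / 2) ^ Y E"
      by (cases "real (Y E) < y") (simp_all del: one_le_exp_iff)
  qed
  also have "\<dots> \<le> exp y * exp (- real (card R) * p / 2)"
    using expY by simp
  also have "\<dots> = exp (- y)" by (simp add: exp_add[symmetric] y_def)
  finally have "measure_pmf.prob M {E. real (Y E) < y} \<le> exp (- y)" .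
  moreover have "Y E = card {v\<in>R. \<forall>u\<in>U. {u, v} \<in> E}" for E
    unfolding Y_def S_def by (intro arg_cong[of _ _ card]) auto
  ultimately show ?thesis by (simp add: M y_def)
qed

section \<open>First moment of cliques with prescribed intersection\<close>

lemma binomial_le_power: "n choose k \<le> n ^ k"
  by (cases "k \<le> n") (auto intro: binomial_le_pow simp: binomial_eq_0)

text \<open>A set is determined by its parts inside and outside \<open>K\<close>. Weakening the
  binomials to powers costs only lower-order terms in the exponent for sets of logarithmic
  size.\<close>

lemma card_subsets_with_intersection_le:
  assumes "finite V" "K \<subseteq> V" "r \<le> q"
  shows "card {C. C \<subseteq> V \<and> card C = q \<and> card (C \<inter> K) = r} \<le> card K ^ r * card V ^ (q - r)"
proof -
  have finK: "finite K" using assms by (auto intro: finite_subset)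
  have "card {C. C \<subseteq> V \<and> card C = q \<and> card (C \<inter> K) = r} \<le>
      card ({A. A \<subseteq> K \<and> card A = r} \<times> {B. B \<subseteq> V \<and> card B = q - r})"
  proof (rule card_inj_on_le)
    show "inj_on (\<lambda>C. (C \<inter> K, C - K)) {C. C \<subseteq> V \<and> card C = q \<and> card (C \<inter> K) = r}"
      by (auto simp: inj_on_def)
    show "(\<lambda>C. (C \<inter> K, C - K)) ` {C. C \<subseteq> V \<and> card C = q \<and> card (C \<inter> K) = r} \<subseteq>
        {A. A \<subseteq> K \<and> card A = r} \<times> {B. B \<subseteq> V \<and> card B = q - r}"
      using finK by (auto simp: card_Diff_subset_Int)
    show "finite ({A. A \<subseteq> K \<and> card A = r} \<times> {B. B \<subseteq> V \<and> card B = q - r})"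
      using finK assms(1) by auto
  qed
  also have "\<dots> = (card K choose r) * (card V choose (q - r))"
    using finK assms(1) by (simp add: card_cartesian_product n_subsets)
  also have "\<dots> \<le> card K ^ r * card V ^ (q - r)"
    by (intro mult_le_mono binomial_le_power)
  finally show ?thesis .
qed

text \<open>Pairs inside \<open>K\<close> are edges already, so a set with \<open>r\<close> of its
  \<open>q\<close> vertices in \<open>K\<close> needs only
  \<open>(q choose 2) - (r choose 2)\<close> random edges.\<close>

lemma expectation_card_cliques_le:
  assumes "finite V" "K \<subseteq> V" "r \<le> q"
  shows "measure_pmf.expectation (random_graph V (1 / 2))
      (\<lambda>E. real (card {C \<in> cliques V (E \<union> vertex_pairs K). card C = q \<and> card (C \<inter> K) = r})) \<le>
    real (card K) ^ r * real (card V) ^ (q - r) * (1 / 2) ^ ((q choose 2) - (r choose 2))"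
proof -
  define A where "A = vertex_pairs V"
  have finA: "finite A" using assms by (simp add: A_def finite_vertex_pairs)
  define M where "M = pmf_of_set (Pow A)"
  have M: "random_graph V (1 / 2) = M" using assms by (simp add: M_def A_def random_graph_half)
  have finM: "finite (set_pmf M)" unfolding M_def using finA by (subst set_pmf_of_set) auto
  define \<C> where "\<C> = {C. C \<subseteq> V \<and> card C = q \<and> card (C \<inter> K) = r}"
  have fin\<C>: "finite \<C>" using assms by (simp add: \<C>_def)
  have prob: "measure_pmf.prob M {E. vertex_pairs C - vertex_pairs K \<subseteq> E} =
      (1 / 2) ^ ((q choose 2) - (r choose 2))" if "C \<in> \<C>" for C
  proof -
    have C: "C \<subseteq> V" "card C = q" "card (C \<inter> K) = r" using that by (auto simp: \<C>_def)
    then have finC: "finite C" using assms by (auto intro: finite_subset)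
    have "card (vertex_pairs C - vertex_pairs K) = card (vertex_pairs C) - card (vertex_pairs (C \<inter> K))"
      using finC by (subst card_Diff_subset_Int) (auto simp: vertex_pairs_Int finite_vertex_pairs)
    also have "\<dots> = (q choose 2) - (r choose 2)"
      using C finC by (simp add: card_vertex_pairs)
    finally show ?thesis
      unfolding M_def using vertex_pairs_mono[OF C(1)] finA
      by (subst prob_supersets) (auto simp: A_def)
  qed
  have "measure_pmf.expectation M
      (\<lambda>E. real (card {C \<in> cliques V (E \<union> vertex_pairs K). card C = q \<and> card (C \<inter> K) = r})) =
    measure_pmf.expectation M (\<lambda>E. \<Sum>C\<in>\<C>. indicator {E. vertex_pairs C - vertex_pairs K \<subseteq> E} E)"
  proof (intro Bochner_Integration.integral_cong refl)
    fix E
    have "{C \<in> cliques V (E \<union> vertex_pairs K). card C = q \<and> card (C \<inter> K) = r} =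
        \<C> \<inter> {C. vertex_pairs C - vertex_pairs K \<subseteq> E}"
      by (auto simp: cliques_iff_vertex_pairs \<C>_def)
    then show "real (card {C \<in> cliques V (E \<union> vertex_pairs K). card C = q \<and> card (C \<inter> K) = r}) =
        (\<Sum>C\<in>\<C>. indicator {E. vertex_pairs C - vertex_pairs K \<subseteq> E} E)"
      using fin\<C> by (simp add: indicator_def sum.If_cases)
  qed
  also have "\<dots> = (\<Sum>C\<in>\<C>. measure_pmf.prob M {E. vertex_pairs C - vertex_pairs K \<subseteq> E})"
    by (subst Bochner_Integration.integral_sum) (auto intro: integrable_measure_pmf_finite finM)
  also have "\<dots> = real (card \<C>) * (1 / 2) ^ ((q choose 2) - (r choose 2))"
    using prob by simp
  also have "\<dots> \<le> real (card K ^ r * card V ^ (q - r)) * (1 / 2) ^ ((q choose 2) - (r choose 2))"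
    unfolding \<C>_def
    by (intro mult_right_mono of_nat_mono card_subsets_with_intersection_le assms) auto
  finally show ?thesis by (simp add: M)
qed

section \<open>Typical graphs: many extensions and few cliques on the crossing level\<close>

definition many_extensions :: "'v set \<Rightarrow> 'v set set \<Rightarrow> nat \<Rightarrow> (nat \<Rightarrow> real) \<Rightarrow> bool" where
  "many_extensions V E s N \<longleftrightarrow>
     (\<forall>X\<in>cliques V E. card X < s \<longrightarrow>
        N (card X) \<le> real (card {v\<in>V - X. insert v X \<in> cliques V E}))"

text \<open>The count is an integer, so \<open>W q < 1\<close> rules out such cliques altogether;
  this is how oversized ones are excluded.\<close>

definition few_crossing_cliques ::
    "'v set \<Rightarrow> 'v set set \<Rightarrow> 'v set \<Rightarrow> nat \<Rightarrow> (nat \<Rightarrow> real) \<Rightarrow> bool" where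
  "few_crossing_cliques V E K r W \<longleftrightarrow>
     (\<forall>q\<in>{r..card V}. real (card {Y \<in> cliques V E. card Y = q \<and> card (Y \<inter> K) = r}) \<le> W q)"

text \<open>Only extensions by vertices outside \<open>K\<close> are counted, since no planted edge
  touches them. At least half of all vertices remain, and each small set keeps a quarter of its
  expected common neighbours there, whence the divisor 8.\<close>

lemma prob_not_many_extensions_le:
  fixes V K :: "'v set"
  assumes "finite V" "K \<subseteq> V" "2 * (s + card K) \<le> card V" "V \<noteq> {}"
  shows "measure_pmf.prob (random_graph V (1 / 2))
      {E. \<not> many_extensions V (E \<union> vertex_pairs K) s (\<lambda>i. real (card V) * (1 / 2) ^ i / 8)} \<le>
    real s * real (card V) ^ s * exp (- real (card V) * (1 / 2) ^ s / 8)"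
proof -
  define n where "n = card V"
  have n: "n \<ge> 1" using assms by (simp add: n_def card_gt_0_iff Suc_le_eq)
  \<comment> \<open>The union bound runs over all vertex sets of size below \<open>s\<close>, not
    only over cliques, so that \<open>U\<close> is fixed before the graph is drawn.\<close>
  define \<U> where "\<U> = {U. U \<subseteq> V \<and> card U < s}"
  define bad where "bad = (\<lambda>U. {E. real (card {v\<in>V - (U \<union> K). \<forall>u\<in>U. {u, v} \<in> E})
      < real (card (V - (U \<union> K))) * (1 / 2) ^ card U / 4})"
  have fin\<U>: "finite \<U>" using assms by (simp add: \<U>_def)
  have half: "real n / 2 \<le> real (card (V - (U \<union> K)))" if "U \<in> \<U>" for U
  proof -
    have U: "U \<subseteq> V" "card U < s" using that by (auto simp: \<U>_def)
    have "card (U \<union> K) \<le> card U + card K" by (rule card_Un_le)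
    moreover have "card (V - (U \<union> K)) = card V - card (U \<union> K)"
      using U assms by (intro card_Diff_subset) (auto intro: finite_subset)
    ultimately show ?thesis using U(2) assms(3) by (simp add: n_def)
  qed
  have "measure_pmf.prob (random_graph V (1 / 2))
      {E. \<not> many_extensions V (E \<union> vertex_pairs K) s (\<lambda>i. real (card V) * (1 / 2) ^ i / 8)} \<le>
    measure_pmf.prob (random_graph V (1 / 2)) (\<Union>U\<in>\<U>. bad U)"
  proof (rule measure_pmf.finite_measure_mono, safe)
    fix E assume "\<not> many_extensions V (E \<union> vertex_pairs K) s (\<lambda>i. real (card V) * (1 / 2) ^ i / 8)"
    then obtain X where X: "X \<in> cliques V (E \<union> vertex_pairs K)" "card X < s"
      and less: "real (card {v\<in>V - X. insert v X \<in> cliques V (E \<union> vertex_pairs K)}) <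
        real n * (1 / 2) ^ card X / 8"
      by (auto simp: many_extensions_def not_le n_def)
    have XU: "X \<in> \<U>" using X by (auto simp: \<U>_def cliques_def)
    have "real (card {v\<in>V - (X \<union> K). \<forall>u\<in>X. {u, v} \<in> E}) \<le>
        real (card {v\<in>V - X. insert v X \<in> cliques V (E \<union> vertex_pairs K)})"
      using assms(1) X(1) by (intro of_nat_mono card_mono) (auto simp: cliques_def insert_commute)
    moreover have "real n * (1 / 2) ^ card X / 8 \<le> real (card (V - (X \<union> K))) * (1 / 2) ^ card X / 4"
      using mult_right_mono[OF half[OF XU], of "(1 / 2) ^ card X / 4"] by simp
    ultimately have "E \<in> bad X" using less unfolding bad_def mem_Collect_eq by linarith
    with XU show "E \<in> (\<Union>U\<in>\<U>. bad U)" by blast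
  qed auto
  also have "\<dots> \<le> (\<Sum>U\<in>\<U>. measure_pmf.prob (random_graph V (1 / 2)) (bad U))"
    using fin\<U> by (intro measure_pmf.finite_measure_subadditive_finite) auto
  also have "\<dots> \<le> (\<Sum>U\<in>\<U>. exp (- real n * (1 / 2) ^ s / 8))"
  proof (rule sum_mono)
    fix U assume U: "U \<in> \<U>"
    have "measure_pmf.prob (random_graph V (1 / 2)) (bad U) \<le>
        exp (- real (card (V - (U \<union> K))) * (1 / 2) ^ card U / 4)"
      unfolding bad_def using U assms by (intro prob_common_neighbours_less) (auto simp: \<U>_def)
    also have "real n / 2 * (1 / 2) ^ s \<le> real (card (V - (U \<union> K))) * (1 / 2) ^ card U"
      using half[OF U] U by (intro mult_mono power_decreasing) (auto simp: \<U>_def)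
    then have "exp (- real (card (V - (U \<union> K))) * (1 / 2) ^ card U / 4) \<le> exp (- real n * (1 / 2) ^ s / 8)"
      by simp
    finally show "measure_pmf.prob (random_graph V (1 / 2)) (bad U) \<le> exp (- real n * (1 / 2) ^ s / 8)" .
  qed
  also have "\<dots> = real (card \<U>) * exp (- real n * (1 / 2) ^ s / 8)" by simp
  also have "\<dots> \<le> real s * real n ^ s * exp (- real n * (1 / 2) ^ s / 8)"
  proof (rule mult_right_mono)
    have "card \<U> = card (\<Union>q\<in>{..<s}. {U. U \<subseteq> V \<and> card U = q})"
      unfolding \<U>_def by (intro arg_cong[of _ _ card]) auto
    also have "\<dots> \<le> (\<Sum>q<s. card {U. U \<subseteq> V \<and> card U = q})"
      by (rule card_UN_le) simp
    also have "\<dots> = (\<Sum>q<s. n choose q)" using assms(1) by (simp add: n_subsets n_def)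
    also have "\<dots> \<le> (\<Sum>q<s. n ^ s)"
      using n by (intro sum_mono order.trans[OF binomial_le_power] power_increasing) auto
    finally have "card \<U> \<le> s * n ^ s" by simp
    then show "real (card \<U>) \<le> real s * real n ^ s"
      by (metis of_nat_le_iff of_nat_mult of_nat_power)
  qed auto
  finally show ?thesis by (simp add: n_def)
qed

text \<open>By Markov's inequality, reaching \<open>n ^ 2\<close> times the first-moment bound has
  probability at most \<open>1 / n ^ 2\<close> for each size, and there are at most
  \<open>n + 1\<close> sizes. Nonemptiness of \<open>K\<close> makes the threshold positive.\<close>

lemma prob_not_few_crossing_cliques_le:
  fixes V K :: "'v set"
  assumes "finite V" "K \<subseteq> V" "K \<noteq> {}"
  shows "measure_pmf.prob (random_graph V (1 / 2))
      {E. \<not> few_crossing_cliques V (E \<union> vertex_pairs K) K r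
        (\<lambda>q. real (card V) ^ 2 * (real (card K) ^ r * real (card V) ^ (q - r) *
          (1 / 2) ^ ((q choose 2) - (r choose 2))))} \<le>
    (real (card V) + 1) / real (card V) ^ 2"
proof -
  define n where "n = real (card V)"
  have finK: "finite K" using assms by (auto intro: finite_subset)
  have K: "card K > 0" using assms finK by (simp add: card_gt_0_iff)
  have n: "n > 0" using assms unfolding n_def by (auto simp: card_gt_0_iff)
  define M where "M = random_graph V (1 / 2)"
  have finM: "finite (set_pmf M)"
    unfolding M_def random_graph_half[OF assms(1)] using assms(1)
    by (subst set_pmf_of_set) (auto simp: finite_vertex_pairs)
  define Z where "Z = (\<lambda>q E. real (card {Y \<in> cliques V (E \<union> vertex_pairs K). card Y = q \<and> card (Y \<inter> K) = r}))"
  define \<mu> where "\<mu> = (\<lambda>q. real (card K) ^ r * n ^ (q - r) * (1 / 2) ^ ((q choose 2) - (r choose 2)))"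
  have \<mu>: "\<mu> q > 0" for q using K n by (simp add: \<mu>_def)
  have "measure_pmf.prob M {E. \<not> few_crossing_cliques V (E \<union> vertex_pairs K) K r (\<lambda>q. n ^ 2 * \<mu> q)} \<le>
    measure_pmf.prob M (\<Union>q\<in>{r..card V}. {E. Z q E \<ge> n ^ 2 * \<mu> q})"
    by (intro measure_pmf.finite_measure_mono)
       (auto simp: few_crossing_cliques_def Z_def not_le intro: less_imp_le)
  also have "\<dots> \<le> (\<Sum>q\<in>{r..card V}. measure_pmf.prob M {E. Z q E \<ge> n ^ 2 * \<mu> q})"
    by (intro measure_pmf.finite_measure_subadditive_finite) auto
  also have "\<dots> \<le> (\<Sum>q\<in>{r..card V}. 1 / n ^ 2)"
  proof (rule sum_mono)
    fix q assume q: "q \<in> {r..card V}"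
    have "measure_pmf.prob M {E. Z q E \<ge> n ^ 2 * \<mu> q} \<le>
        measure_pmf.expectation M (Z q) / (n ^ 2 * \<mu> q)"
      using integral_Markov_inequality_measure[of "measure_pmf M" "Z q" "{}" "n ^ 2 * \<mu> q"] \<mu>[of q] n
      by (simp add: integrable_measure_pmf_finite[OF finM] Z_def)
    also have "\<dots> \<le> \<mu> q / (n ^ 2 * \<mu> q)"
      using expectation_card_cliques_le[OF assms(1,2), of r q] q \<mu>[of q] n
      by (intro divide_right_mono) (auto simp: M_def Z_def \<mu>_def n_def)
    also have "\<dots> = 1 / n ^ 2" using \<mu>[of q] by simp
    finally show "measure_pmf.prob M {E. Z q E \<ge> n ^ 2 * \<mu> q} \<le> 1 / n ^ 2" .
  qed
  also have "\<dots> \<le> (n + 1) / n ^ 2"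
    using n by (simp add: n_def divide_right_mono)
  finally show ?thesis by (simp add: M_def \<mu>_def n_def)
qed

text \<open>The random edges and the planted set are drawn independently, so the planted set can be
  drawn first; a bound valid for every fixed \<open>K\<close> then survives averaging.\<close>

lemma prob_planted_clique_model_le:
  assumes "finite V" "k \<le> card V"
    and "\<And>K. K \<subseteq> V \<Longrightarrow> card K = k \<Longrightarrow>
      measure_pmf.prob (random_graph V (1 / 2)) {E. P (E \<union> vertex_pairs K, K)} \<le> \<delta>"
  shows "measure_pmf.prob (planted_clique_model V k) {x. P x} \<le> \<delta>"
proof -
  define \<K> where "\<K> = {K. K \<subseteq> V \<and> card K = k}"
  have fin: "finite \<K>" using assms(1) by (simp add: \<K>_def)
  obtain K\<^sub>0 where "K\<^sub>0 \<in> \<K>"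
    using obtain_subset_with_card_n[OF assms(2)] by (auto simp: \<K>_def)
  then have \<delta>: "\<delta> \<ge> 0"
    using assms(3)[of K\<^sub>0] by (auto simp: \<K>_def intro: order.trans[OF measure_nonneg])
  have set: "set_pmf (pmf_of_set \<K>) = \<K>" using fin \<open>K\<^sub>0 \<in> \<K>\<close> by (intro set_pmf_of_set) auto
  have "planted_clique_model V k =
      bind_pmf (pmf_of_set \<K>) (\<lambda>K. map_pmf (\<lambda>E. (E \<union> vertex_pairs K, K)) (random_graph V (1 / 2)))"
    unfolding planted_clique_model_def \<K>_def map_pmf_def by (rule bind_commute_pmf)
  then have "emeasure (planted_clique_model V k) {x. P x} =
      (\<integral>\<^sup>+K. emeasure (random_graph V (1 / 2)) {E. P (E \<union> vertex_pairs K, K)} \<partial>pmf_of_set \<K>)"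
    by (simp add: vimage_def)
  also have "\<dots> \<le> (\<integral>\<^sup>+K. ennreal \<delta> \<partial>pmf_of_set \<K>)"
    using assms(3) by (intro nn_integral_mono_AE)
      (auto simp: AE_measure_pmf_iff set[unfolded \<K>_def] \<K>_def measure_pmf.emeasure_eq_measure ennreal_leI)
  also have "\<dots> = ennreal \<delta>" by simp
  finally show ?thesis
    using \<delta> by (simp add: measure_pmf.emeasure_eq_measure)
qed

section \<open>High-probability statements in the planted model\<close>

lemma whpI:
  assumes "\<forall>\<^sub>F n in sequentially. measure_pmf.prob (M n) {x. \<not> P n x} \<le> \<delta> n" "\<delta> \<longlonglongrightarrow> 0"
  shows "whp M P"
  unfolding whp_def
proof (rule tendsto_sandwich[where f = "\<lambda>n. 1 - \<delta> n" and h = "\<lambda>_. 1"])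
  have "measure_pmf.prob (M n) {x. \<not> P n x} = 1 - measure_pmf.prob (M n) {x. P n x}" for n
  proof -
    have *: "{x. \<not> P n x} = space (measure_pmf (M n)) - {x. P n x}" by auto
    show ?thesis unfolding * by (rule measure_pmf.prob_compl) simp
  qed
  with assms(1) show "\<forall>\<^sub>F n in sequentially. 1 - \<delta> n \<le> measure_pmf.prob (M n) {x. P n x}"
    by (auto elim!: eventually_mono)
  show "(\<lambda>n. 1 - \<delta> n) \<longlonglongrightarrow> 1"
    using tendsto_diff[OF tendsto_const assms(2), of 1] by simp
qed auto

text \<open>Restricting the implication to the support gives access to the deterministic size of the
  planted clique.\<close>

lemma whp_mono:
  assumes "whp M P" "\<forall>\<^sub>F n in sequentially. \<forall>x\<in>set_pmf (M n). P n x \<longrightarrow> Q n x"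
  shows "whp M Q"
  unfolding whp_def
proof (rule tendsto_sandwich[OF _ _ assms(1)[unfolded whp_def] tendsto_const[of 1]])
  show "\<forall>\<^sub>F n in sequentially. measure_pmf.prob (M n) {x. P n x} \<le> measure_pmf.prob (M n) {x. Q n x}"
    using assms(2)
    by eventually_elim (auto intro!: measure_pmf.finite_measure_mono_AE simp: AE_measure_pmf_iff)
qed auto

lemma set_planted_clique_model:
  assumes "finite V" "k \<le> card V" "(E, K) \<in> set_pmf (planted_clique_model V k)"
  shows "K \<subseteq> V \<and> card K = k"
proof -
  obtain K\<^sub>0 where "K\<^sub>0 \<subseteq> V" "card K\<^sub>0 = k"
    using obtain_subset_with_card_n[OF assms(2)] by blast
  then have "set_pmf (pmf_of_set {K. K \<subseteq> V \<and> card K = k}) = {K. K \<subseteq> V \<and> card K = k}"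
    using assms(1) by (intro set_pmf_of_set) auto
  then show ?thesis using assms(3) by (auto simp: planted_clique_model_def)
qed

lemma planted_size_le:
  fixes \<alpha> :: real
  assumes "\<alpha> < 1" "n > 0"
  shows "nat \<lfloor>real n powr \<alpha>\<rfloor> \<le> n"
proof -
  have "real n powr \<alpha> \<le> real n powr 1" using assms by (intro powr_mono) auto
  then have "\<lfloor>real n powr \<alpha>\<rfloor> \<le> \<lfloor>real n\<rfloor>" using assms by (intro floor_mono) simp
  then show ?thesis by simp
qed

lemma card_planted_power_model:
  assumes "\<alpha> < 1" "n > 0" "(E, K) \<in> set_pmf (planted_power_model \<alpha> n)"
  shows "card K = nat \<lfloor>real n powr \<alpha>\<rfloor>"
  using set_planted_clique_model[of "{..<n}" "nat \<lfloor>real n powr \<alpha>\<rfloor>" E K] planted_size_le[of \<alpha> n] assms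
  by (auto simp: planted_power_model_def)

text \<open>Since \<open>s \<le> (1 - \<epsilon>) * L\<close>, the expected number of extensions is,
  up to constants, at least \<open>2 powr (\<epsilon> * L)\<close>. This is a power of
  \<open>n\<close>, and its exponential beats the \<open>L * 2 powr (L^2)\<close> bounding the
  number of sets in the union bound.\<close>

lemma prob_planted_power_model_atypical_le:
  fixes \<alpha> \<epsilon> :: real and n r :: nat
  defines "L \<equiv> log 2 (real n)"
  defines "s \<equiv> nat \<lfloor>(1 - \<epsilon>) * L\<rfloor>"
  assumes \<alpha>: "0 < \<alpha>" "\<alpha> < 1" and \<epsilon>: "0 < \<epsilon>" "\<epsilon> < 1"
    and n: "2 * (L + real n powr \<alpha>) \<le> real n" "1 \<le> L"
  shows "measure_pmf.prob (planted_power_model \<alpha> n) {x. \<not> (case x of (E, K) \<Rightarrow>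
      many_extensions {..<n} E s (\<lambda>i. real n * (1 / 2) ^ i / 8) \<and>
      few_crossing_cliques {..<n} E K r (\<lambda>q. real n ^ 2 * (real (card K) ^ r *
        real n ^ (q - r) * (1 / 2) ^ ((q choose 2) - (r choose 2)))))} \<le>
    L * 2 powr (L^2) * exp (- (2 powr (\<epsilon> * L)) / 8) + (real n + 1) / real n ^ 2"
  unfolding planted_power_model_def
proof (rule prob_planted_clique_model_le)
  have n0: "n > 0" using n(2) by (cases n) (auto simp: L_def log_def)
  have nL: "real n = 2 powr L" using n0 by (simp add: L_def)
  show "nat \<lfloor>real n powr \<alpha>\<rfloor> \<le> card {..<n}" using planted_size_le[of \<alpha> n] \<alpha> n0 by simp
  fix K assume K: "K \<subseteq> {..<n}" "card K = nat \<lfloor>real n powr \<alpha>\<rfloor>"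
  have k: "1 \<le> real n powr \<alpha>" using \<alpha> n0 by (intro ge_one_powr_ge_zero) auto
  then have "1 \<le> card K" unfolding K(2) by linarith
  then have K0: "K \<noteq> {}" by auto
  have "0 \<le> (1 - \<epsilon>) * L" using \<epsilon> n(2) by simp
  then have s: "real s \<le> (1 - \<epsilon>) * L" unfolding s_def by linarith
  also have "\<dots> \<le> 1 * L" using \<epsilon> n(2) by (intro mult_right_mono) auto
  finally have sL: "real s \<le> L" by simp
  have "real (card K) \<le> real n powr \<alpha>" unfolding K(2) using k by linarith
  then have "real (2 * (s + card K)) \<le> real n" using sL n(1) by simp
  then have sK: "2 * (s + card K) \<le> card {..<n}" unfolding card_lessThan by linarith
  have ne: "{..<n} \<noteq> {}" using n0 by blast
  define B1 where "B1 = {E. \<not> many_extensions {..<n} (E \<union> vertex_pairs K) s (\<lambda>i. real (card {..<n}) * (1 / 2) ^ i / 8)}"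
  define B2 where "B2 = {E. \<not> few_crossing_cliques {..<n} (E \<union> vertex_pairs K) K r
        (\<lambda>q. real (card {..<n}) ^ 2 * (real (card K) ^ r * real (card {..<n}) ^ (q - r) *
          (1 / 2) ^ ((q choose 2) - (r choose 2))))}"
  define M where "M = random_graph {..<n} (1 / 2)"
  have "measure_pmf.prob M B1 \<le> real s * real n ^ s * exp (- real n * (1 / 2) ^ s / 8)"
    using prob_not_many_extensions_le[of "{..<n}" K s] K sK ne by (simp add: M_def B1_def)
  also have "\<dots> \<le> L * 2 powr (L^2) * exp (- (2 powr (\<epsilon> * L)) / 8)"
  proof (intro mult_mono)
    have "real n ^ s = 2 powr (L * real s)" unfolding nL by (simp add: powr_power mult.commute)
    also have "\<dots> \<le> 2 powr (L^2)"
      using sL n(2) by (intro powr_mono) (auto simp: power2_eq_square intro: mult_left_mono)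
    finally show "real n ^ s \<le> 2 powr (L^2)" .
    have "2 powr (\<epsilon> * L) \<le> 2 powr (L - real s)" using s by (intro powr_mono) (auto simp: algebra_simps)
    also have "\<dots> = real n * (1 / 2) ^ s"
      unfolding nL by (simp add: powr_diff powr_realpow power_one_over)
    finally show "exp (- real n * (1 / 2) ^ s / 8) \<le> exp (- (2 powr (\<epsilon> * L)) / 8)" by simp
  qed (use sL n(2) in auto)
  finally have 1: "measure_pmf.prob M B1 \<le> L * 2 powr (L^2) * exp (- (2 powr (\<epsilon> * L)) / 8)" .
  have 2: "measure_pmf.prob M B2 \<le> (real n + 1) / real n ^ 2"
    using prob_not_few_crossing_cliques_le[of "{..<n}" K r] K K0 by (simp add: M_def B2_def)
  have "measure_pmf.prob M (B1 \<union> B2) \<le> measure_pmf.prob M B1 + measure_pmf.prob M B2"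
    by (rule measure_Un_le) auto
  with 1 2 have "measure_pmf.prob M (B1 \<union> B2) \<le>
      L * 2 powr (L^2) * exp (- (2 powr (\<epsilon> * L)) / 8) + (real n + 1) / real n ^ 2" by linarith
  moreover have "B1 \<union> B2 = {E. \<not> (case (E \<union> vertex_pairs K, K) of (E, K) \<Rightarrow>
      many_extensions {..<n} E s (\<lambda>i. real n * (1 / 2) ^ i / 8) \<and>
      few_crossing_cliques {..<n} E K r (\<lambda>q. real n ^ 2 * (real (card K) ^ r *
        real n ^ (q - r) * (1 / 2) ^ ((q choose 2) - (r choose 2)))))}"
    by (auto simp: B1_def B2_def)
  ultimately show "measure_pmf.prob (random_graph {..<n} (1 / 2)) {E. \<not> (case (E \<union> vertex_pairs K, K) of (E, K) \<Rightarrow>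
      many_extensions {..<n} E s (\<lambda>i. real n * (1 / 2) ^ i / 8) \<and>
      few_crossing_cliques {..<n} E K r (\<lambda>q. real n ^ 2 * (real (card K) ^ r *
        real n ^ (q - r) * (1 / 2) ^ ((q choose 2) - (r choose 2)))))} \<le>
      L * 2 powr (L^2) * exp (- (2 powr (\<epsilon> * L)) / 8) + (real n + 1) / real n ^ 2"
    by (simp add: M_def)
qed simp

lemma filterlim_log2_nat: "filterlim (\<lambda>n::nat. log 2 (real n)) at_top sequentially"
  by real_asymp

lemma whp_typical:
  fixes \<alpha> \<epsilon> :: real and r :: "nat \<Rightarrow> nat"
  assumes \<alpha>: "0 < \<alpha>" "\<alpha> < 1" and \<epsilon>: "0 < \<epsilon>" "\<epsilon> < 1"
  shows "whp (planted_power_model \<alpha>) (\<lambda>n (E, K).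
    many_extensions {..<n} E (nat \<lfloor>(1 - \<epsilon>) * log 2 (real n)\<rfloor>) (\<lambda>i. real n * (1 / 2) ^ i / 8) \<and>
    few_crossing_cliques {..<n} E K (r n) (\<lambda>q. real n ^ 2 * (real (card K) ^ r n *
      real n ^ (q - r n) * (1 / 2) ^ ((q choose 2) - (r n choose 2)))))"
proof (rule whpI)
  have "\<forall>\<^sub>F n in sequentially. 2 * (log 2 (real n) + real n powr \<alpha>) \<le> real n"
    using \<alpha> by real_asymp
  moreover have "\<forall>\<^sub>F n in sequentially. 1 \<le> log 2 (real n)"
    by real_asymp
  ultimately show "\<forall>\<^sub>F n in sequentially. measure_pmf.prob (planted_power_model \<alpha> n) {x. \<not> (case x of (E, K) \<Rightarrow>
      many_extensions {..<n} E (nat \<lfloor>(1 - \<epsilon>) * log 2 (real n)\<rfloor>) (\<lambda>i. real n * (1 / 2) ^ i / 8) \<and>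
      few_crossing_cliques {..<n} E K (r n) (\<lambda>q. real n ^ 2 * (real (card K) ^ r n *
        real n ^ (q - r n) * (1 / 2) ^ ((q choose 2) - (r n choose 2)))))} \<le>
    log 2 (real n) * 2 powr ((log 2 (real n))^2) * exp (- (2 powr (\<epsilon> * log 2 (real n))) / 8) +
      (real n + 1) / real n ^ 2"
    by eventually_elim (rule prob_planted_power_model_atypical_le[OF \<alpha> \<epsilon>])
  \<comment> \<open>The limit is taken in a real variable \<open>L\<close> tending to infinity and
    then composed with the logarithm.\<close>
  have "((\<lambda>L::real. L * 2 powr (L^2) * exp (- (2 powr (\<epsilon> * L)) / 8)) \<longlongrightarrow> 0) at_top"
    using \<epsilon> by real_asymp
  from filterlim_compose[OF this filterlim_log2_nat]
  have "(\<lambda>n. log 2 (real n) * 2 powr ((log 2 (real n))^2) * exp (- (2 powr (\<epsilon> * log 2 (real n))) / 8)) \<longlonglongrightarrow> 0" .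
  moreover have "(\<lambda>n. (real n + 1) / real n ^ 2) \<longlonglongrightarrow> 0" by real_asymp
  ultimately show "(\<lambda>n. log 2 (real n) * 2 powr ((log 2 (real n))^2) * exp (- (2 powr (\<epsilon> * log 2 (real n))) / 8) +
      (real n + 1) / real n ^ 2) \<longlonglongrightarrow> 0"
    by (rule tendsto_add_zero)
qed

section \<open>The bottleneck exponent\<close>

lemma real_choose_two: "real (n choose 2) = real n * (real n - 1) / 2"
proof -
  have "even (n * (n - 1))" by (cases n) auto
  then have "real (n choose 2) = real (n * (n - 1)) / 2"
    by (simp add: choose_two real_of_nat_div)
  then show ?thesis by (cases n) (auto simp: algebra_simps)
qed

text \<open>Each factor is at most \<open>8 * L * 2 powr (i - L)\<close>. The exponents
  \<open>i - L\<close> sum to at most \<open>s^2 / 2 - (s - q0) * L\<close>, and the factors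
  \<open>8 * L\<close> give the lower-order term with the logarithm.\<close>

lemma prod_ratio_le_powr:
  fixes L :: real
  assumes "q0 \<le> s" "real s \<le> L" "1 \<le> L"
  shows "(\<Prod>i = q0..<s. real (Suc i) / (2 powr L * (1 / 2) ^ i / 8)) \<le>
    2 powr ((real s - real q0) * (log 2 (8 * L) - L) + real s ^ 2 / 2)"
  using assms(1,2)
proof (induction s rule: dec_induct)
  case base
  then show ?case by (simp add: ge_one_powr_ge_zero)
next
  case (step s)
  define b where "b = log 2 (8 * L)"
  have "real (Suc s) / (2 powr L * (1 / 2) ^ s / 8) = (8 * real (Suc s)) * (2 powr real s / 2 powr L)"
    by (simp add: powr_realpow power_divide field_simps)
  also have "\<dots> \<le> (8 * L) * (2 powr real s / 2 powr L)"
    using step.prems by (intro mult_right_mono) auto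
  also have "8 * L = 2 powr b" using assms(3) by (simp add: b_def)
  also have "2 powr b * (2 powr real s / 2 powr L) = 2 powr (b - L + real s)"
    by (simp add: powr_diff powr_add)
  finally have le: "real (Suc s) / (2 powr L * (1 / 2) ^ s / 8) \<le> 2 powr (b - L + real s)" .
  have "(\<Prod>i = q0..<Suc s. real (Suc i) / (2 powr L * (1 / 2) ^ i / 8)) \<le>
      2 powr ((real s - real q0) * (b - L) + real s ^ 2 / 2) * 2 powr (b - L + real s)"
    unfolding prod.atLeastLessThan_Suc[OF step.hyps(1)] b_def
    using step.IH step.prems le unfolding b_def by (intro mult_mono) auto
  also have "\<dots> \<le> 2 powr ((real (Suc s) - real q0) * (b - L) + real (Suc s) ^ 2 / 2)"
    unfolding powr_add[symmetric] by (intro powr_mono) (auto simp: power2_eq_square field_simps)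
  finally show ?case by (simp add: b_def)
qed

lemma crossing_count_le_powr:
  fixes L \<alpha> :: real
  assumes "r \<le> q" "real k \<le> 2 powr (\<alpha> * L)"
  shows "(2 powr L)^2 * (real k ^ r * (2 powr L) ^ (q - r) * (1 / 2) ^ ((q choose 2) - (r choose 2))) \<le>
    2 powr (2 * L + \<alpha> * L * r + L * (real q - real r)
      - real q * (real q - 1) / 2 + real r * (real r - 1) / 2)"
proof -
  have "r choose 2 \<le> q choose 2" using assms(1) by (rule binomial_right_mono)
  then have "- real ((q choose 2) - (r choose 2)) =
      - (real q * (real q - 1) / 2 - real r * (real r - 1) / 2)"
    by (simp only: of_nat_diff real_choose_two)
  moreover have "(1 / 2 :: real) ^ m = 2 powr (- real m)" for m
    by (simp add: powr_minus powr_realpow power_one_over inverse_eq_divide)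
  ultimately have "(1 / 2 :: real) ^ ((q choose 2) - (r choose 2)) =
      2 powr (- (real q * (real q - 1) / 2 - real r * (real r - 1) / 2))"
    by (simp only:)
  moreover have "(2 powr L) ^ (q - r) = 2 powr (L * (real q - real r))"
    using assms(1) by (simp add: powr_power of_nat_diff mult.commute)
  moreover have "(2 powr L)^2 = 2 powr (2 * L)"
    by (simp add: powr_power)
  moreover have "real k ^ r \<le> 2 powr (\<alpha> * L * r)"
  proof -
    have "real k ^ r \<le> (2 powr (\<alpha> * L)) ^ r" using assms(2) by (intro power_mono) auto
    then show ?thesis by (simp add: powr_power mult.commute mult.left_commute)
  qed
  ultimately have "(2 powr L)^2 * (real k ^ r * (2 powr L) ^ (q - r) * (1 / 2) ^ ((q choose 2) - (r choose 2))) \<le>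
     2 powr (2 * L) * (2 powr (\<alpha> * L * r) * 2 powr (L * (real q - real r)) *
       2 powr (- (real q * (real q - 1) / 2 - real r * (real r - 1) / 2)))"
    by (simp only:) (intro mult_left_mono mult_right_mono, auto)
  then show ?thesis by (simp add: powr_add[symmetric] algebra_simps)
qed

section \<open>Quadratic inequalities for the exponents\<close>

context
  fixes \<alpha> \<gamma> L r :: real
  assumes \<gamma>: "0 < \<gamma>" "\<gamma> < 1 - \<alpha>" "0 < \<alpha>" and L: "30 \<le> L" and r: "\<gamma> * L \<le> r" "r \<le> \<gamma> * L + 1"
begin

text \<open>Rounding \<open>r\<close> up costs nothing: \<open>r - 1 \<le> \<gamma> * L\<close>
  absorbs it in the quadratic term, and the remaining slope in \<open>r\<close> is negative because
  \<open>\<gamma> < 1 - \<alpha>\<close>.\<close>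

lemma crossing_energy_le:
  "- (1 - \<alpha>) * L * r + r * (r - 1) / 2 \<le> \<gamma> * L^2 * (\<gamma> / 2 - (1 - \<alpha>))"
proof -
  have r0: "0 \<le> r" using r(1) \<gamma> L by (smt (verit) mult_nonneg_nonneg)
  have "r * (r - 1) \<le> r * (\<gamma> * L)" using r0 r by (intro mult_left_mono) auto
  then have "- (1 - \<alpha>) * L * r + r * (r - 1) / 2 \<le> r * (L * (\<gamma> / 2 - (1 - \<alpha>)))"
    by (simp add: algebra_simps)
  also have "\<dots> \<le> (\<gamma> * L) * (L * (\<gamma> / 2 - (1 - \<alpha>)))"
    using r \<gamma> L by (intro mult_right_mono_neg mult_nonneg_nonpos) auto
  finally show ?thesis by (simp add: power2_eq_square algebra_simps)
qed

text \<open>Beyond \<open>2.1 * L\<close> the first-moment bound, even with its factor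
  \<open>n ^ 2\<close>, is below one: the pairs cost about \<open>q^2 / 2\<close>, which exceeds the
  gain \<open>q * L\<close> by an amount of order \<open>L^2\<close>. The Lipschitz condition stops
  at the same size.\<close>

lemma large_size_exponent_neg:
  fixes q :: real
  assumes "2.1 * L < q"
  shows "2 * L + \<alpha> * L * r + L * (q - r) - q * (q - 1) / 2 + r * (r - 1) / 2 < 0"
proof -
  have "\<gamma> * L^2 * (\<gamma> / 2 - (1 - \<alpha>)) \<le> 0" using \<gamma> by (intro mult_nonneg_nonpos) auto
  moreover have "L * q - q * (q - 1) / 2 = q * (L - (q - 1) / 2)" by (simp add: field_simps)
  moreover have "q * (L - (q - 1) / 2) \<le> q * (1 / 2 - L / 20)"
  proof (rule mult_left_mono)
    show "L - (q - 1) / 2 \<le> 1 / 2 - L / 20" using assms by (simp add: field_simps)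
    show "0 \<le> q" using assms L by linarith
  qed
  moreover have "q * (1 / 2 - L / 20) \<le> (2.1 * L) * (1 / 2 - L / 20)"
    using assms L by (intro mult_right_mono_neg) auto
  moreover have "2 * L + (2.1 * L) * (1 / 2 - L / 20) = L * (3.05 - 0.105 * L)"
    by (simp add: field_simps)
  \<comment> \<open>The bound \<open>30 \<le> L\<close> is made for this:
    \<open>0.105 * 30 = 3.15\<close>, just above \<open>3.05\<close>.\<close>
  moreover have "L * (3.05 - 0.105 * L) < 0" using L by (intro mult_pos_neg) auto
  moreover have "2 * L + \<alpha> * L * r + L * (q - r) - q * (q - 1) / 2 + r * (r - 1) / 2 =
     2 * L + (L * q - q * (q - 1) / 2) + (- (1 - \<alpha>) * L * r + r * (r - 1) / 2)"
    by (simp add: algebra_simps)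
  ultimately show ?thesis using crossing_energy_le by linarith
qed

text \<open>The three groups are the exponents of the clique count, of the Lipschitz bound on
  \<open>exp (\<beta> * (h q - h s))\<close> and of the product of ratios. Their leading terms are
  at most \<open>- D * L^2\<close>; the slack \<open>D / 8\<close> in \<open>s\<close> and in
  \<open>q\<^sub>0\<close> consumes at most half of this.\<close>

lemma crossing_exponent_le:
  fixes q s b q\<^sub>0 :: real
  defines "D \<equiv> \<gamma> * (1 - \<alpha> - \<gamma>)"
  assumes q: "q \<le> 2.1 * L" and s: "0 \<le> s" "s \<le> L" "s \<le> q" "s = q \<or> (1 - D / 8) * L - 1 \<le> s"
    and q\<^sub>0: "0 \<le> q\<^sub>0" "q\<^sub>0 \<le> D / 8 * L" and b: "0 \<le> b"
  shows "(2 * L + \<alpha> * L * r + L * (q - r) - q * (q - 1) / 2 + r * (r - 1) / 2) +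
     \<gamma> * L * (q - s) + ((s - q\<^sub>0) * (b - L) + s^2 / 2) \<le> - D / 2 * L^2 + 6 * L + 1 + L * b"
proof -
  have D: "0 < D" "D \<le> 1"
    unfolding D_def using \<gamma> by (auto intro!: mult_le_one)
  \<comment> \<open>The exponent of \<open>2\<close> gained by stopping the comparison at size \<open>s\<close> instead of \<open>q\<close>. It is largest
    near \<open>q = (1 + \<gamma>) L\<close>, where it is about \<open>\<gamma>\<^sup>2 L\<^sup>2 / 2\<close>.\<close>
  define Q where "Q = (q - s) * ((1 + \<gamma>) * L - s) - (q - s)^2 / 2"
  have Q: "Q \<le> ((\<gamma> + D / 8) * L + 1)^2 / 2"
  proof (cases "s = q")
    case True
    then show ?thesis by (simp add: Q_def)
  next
    case False
    then have s': "(1 - D / 8) * L - 1 \<le> s" using s by simp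
    have "Q = (((1 + \<gamma>) * L - s)^2 - ((1 + \<gamma>) * L - s - (q - s))^2) / 2"
      by (simp add: Q_def power2_eq_square field_simps)
    also have "\<dots> \<le> ((1 + \<gamma>) * L - s)^2 / 2" by simp
    also have "((1 + \<gamma>) * L - s)^2 \<le> ((\<gamma> + D / 8) * L + 1)^2"
    proof (rule power_mono)
      show "(1 + \<gamma>) * L - s \<le> (\<gamma> + D / 8) * L + 1" using s' by (simp add: algebra_simps)
      have "0 \<le> \<gamma> * L" using \<gamma> L by simp
      then show "0 \<le> (1 + \<gamma>) * L - s" using s by (simp add: algebra_simps)
    qed
    finally show ?thesis by simp
  qed
  have "(s - q\<^sub>0) * (b - L) = s * b - q\<^sub>0 * b - s * L + q\<^sub>0 * L" by (simp add: algebra_simps)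
  moreover have "s * b \<le> L * b" "0 \<le> q\<^sub>0 * b" using s b q\<^sub>0 by (auto intro: mult_right_mono)
  moreover have "q\<^sub>0 * L \<le> D / 8 * L^2"
    using mult_right_mono[OF q\<^sub>0(2), of L] L by (simp add: power2_eq_square)
  ultimately have 1: "(s - q\<^sub>0) * (b - L) \<le> L * b - s * L + D / 8 * L^2" by linarith
  have 2: "(2 * L + \<alpha> * L * r + L * (q - r) - q * (q - 1) / 2 + r * (r - 1) / 2) +
     \<gamma> * L * (q - s) + (L * b - s * L + D / 8 * L^2 + s^2 / 2) =
     Q + q / 2 + (- (1 - \<alpha>) * L * r + r * (r - 1) / 2) + 2 * L + L * b + D / 8 * L^2"
    by (simp add: Q_def power2_eq_square field_simps)
  have "((\<gamma> + D / 8) * L + 1)^2 / 2 = (\<gamma>^2 / 2 + \<gamma> * D / 8 + D^2 / 128) * L^2 + (\<gamma> + D / 8) * L + 1 / 2"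
    by (simp add: power2_eq_square field_simps)
  moreover have "(\<gamma> + D / 8) * L \<le> 2 * L" using \<gamma> D L by (intro mult_right_mono) auto
  \<comment> \<open>Since \<gamma> and \<open>D\<close> are at most one, the error terms add up to
    at most \<open>D / 8 + D / 128 + D / 8\<close>, less than \<open>D / 2\<close>.\<close>
  moreover have "(\<gamma>^2 / 2 + \<gamma> * D / 8 + D^2 / 128 + D / 8 + \<gamma> * (\<gamma> / 2 - (1 - \<alpha>))) * L^2 \<le> (- D / 2) * L^2"
  proof (rule mult_right_mono)
    have "\<gamma> * D \<le> 1 * D" using \<gamma> D by (intro mult_right_mono) auto
    moreover have "D^2 \<le> 1 * D" unfolding power2_eq_square using D by (intro mult_right_mono) auto
    moreover have "\<gamma>^2 / 2 + \<gamma> * (\<gamma> / 2 - (1 - \<alpha>)) = - D"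
      by (simp add: D_def power2_eq_square field_simps)
    ultimately show "\<gamma>^2 / 2 + \<gamma> * D / 8 + D^2 / 128 + D / 8 + \<gamma> * (\<gamma> / 2 - (1 - \<alpha>)) \<le> - D / 2"
      using D by linarith
  qed simp
  ultimately show ?thesis
    using Q 1 2 q crossing_energy_le L by (simp add: algebra_simps)
qed

end

text \<open>Of the exponent \<open>D / 2 * L^2\<close> gained for each size, the factors
  \<open>T + 1\<close> and \<open>T\<close> cost \<open>D / 4 * L^2\<close> and the claimed bound
  takes \<open>D / 8 * L^2\<close>. The last \<open>D / 8 * L^2\<close> pays for the lower-order
  terms, which is the second assumption on \<open>L\<close>.\<close>

lemma prob_metropolis_path_crossing_le_powr:
  fixes \<alpha> \<gamma> \<beta> :: real and n T :: nat and h :: "nat \<Rightarrow> real"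
  defines "L \<equiv> log 2 (real n)" and "D \<equiv> \<gamma> * (1 - \<alpha> - \<gamma>)"
  defines "r \<equiv> nat \<lceil>\<gamma> * L\<rceil>" and "s \<equiv> nat \<lfloor>(1 - D / 8) * L\<rfloor>"
  assumes \<alpha>\<gamma>: "0 < \<gamma>" "\<gamma> < 1 - \<alpha>" "0 < \<alpha>"
    and L: "30 \<le> L" "7 * L + 3 + L * log 2 (8 * L) \<le> D / 8 * L^2"
    and K: "real (card K) \<le> real n powr \<alpha>"
    and ext: "many_extensions {..<n} E s (\<lambda>i. real n * (1 / 2) ^ i / 8)"
    and few: "few_crossing_cliques {..<n} E K r (\<lambda>q. real n ^ 2 * (real (card K) ^ r *
      real n ^ (q - r) * (1 / 2) ^ ((q choose 2) - (r choose 2))))"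
    and h: "one_lipschitz n h" and \<beta>: "0 \<le> \<beta>" "\<beta> \<le> ln 2 * \<gamma> * L"
    and C: "C \<in> cliques {..<n} E" "real (card C) \<le> D / 8 * L"
    and T: "real T \<le> real n powr (D / 8 * L)"
  shows "measure_pmf.prob (metropolis_path {..<n} E h \<beta> C T) {Xs. \<exists>t\<le>T. r \<le> card (Xs ! t \<inter> K)} \<le>
    real n powr (- (D / 8) * L)"
proof -
  have n: "n > 0" using L(1) by (cases n) (auto simp: L_def log_def)
  have nL: "real n = 2 powr L" using n by (simp add: L_def)
  have D: "0 < D" "D \<le> 1" unfolding D_def using \<alpha>\<gamma> by (auto intro!: mult_le_one)
  have D\<gamma>: "D / 8 < \<gamma>"
  proof -
    have "D \<le> \<gamma> * 1" unfolding D_def using \<alpha>\<gamma> by (intro mult_left_mono) auto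
    then show ?thesis using D by linarith
  qed
  have \<gamma>L: "0 \<le> \<gamma> * L" using \<alpha>\<gamma> L by simp
  have r: "\<gamma> * L \<le> real r" "real r \<le> \<gamma> * L + 1"
    using \<gamma>L unfolding r_def by linarith+
  have sL0: "0 \<le> (1 - D / 8) * L" using D L by simp
  have s: "real s \<le> (1 - D / 8) * L" "(1 - D / 8) * L - 1 \<le> real s"
    using sL0 unfolding s_def by linarith+
  have DL: "0 \<le> D * L" "D * L \<le> L" using D L by (auto simp: mult_le_cancel_right1)
  have sL: "real s \<le> L" using s(1) DL by (simp add: algebra_simps)
  have Cr: "card C < r"
  proof -
    have "D / 8 * L < \<gamma> * L" using D\<gamma> L by (intro mult_strict_right_mono) auto
    then show ?thesis using C r by linarith
  qed
  have Cs: "card C < s"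
  proof -
    have "(1 - D / 8) * L = L - D / 8 * L" by (simp add: algebra_simps)
    then have "real (card C) < real s" using C(2) s(2) DL L(1) by linarith
    then show ?thesis by simp
  qed
  define b where "b = log 2 (8 * L)"
  have b: "0 \<le> b" using L by (simp add: b_def)
  define X where "X = - D / 2 * L^2 + 6 * L + 1 + L * b"
  define N where "N = (\<lambda>i. real n * (1 / 2) ^ i / 8)"
  have term_le: "real (card {Y \<in> cliques {..<n} E. card Y = q \<and> card (Y \<inter> K) = r}) *
      (exp (\<beta> * (h q - h (min q s))) * (\<Prod>i = card C..<min q s. real (Suc i) / N i)) \<le> 2 powr X"
    if q: "q \<in> {r..n}" for q
  proof -
    define W where "W = card {Y \<in> cliques {..<n} E. card Y = q \<and> card (Y \<inter> K) = r}"
    define e where "e = 2 * L + \<alpha> * L * r + L * (real q - real r)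
      - real q * (real q - 1) / 2 + real r * (real r - 1) / 2"
    have "real W \<le> real n ^ 2 * (real (card K) ^ r *
        real n ^ (q - r) * (1 / 2) ^ ((q choose 2) - (r choose 2)))"
      using few q by (auto simp: few_crossing_cliques_def W_def)
    also have "\<dots> \<le> 2 powr e"
      unfolding e_def nL using q K by (intro crossing_count_le_powr) (auto simp: nL powr_powr mult.commute)
    finally have W: "real W \<le> 2 powr e" .
    show ?thesis
    proof (cases "real q \<le> 2.1 * L")
      case False
      then have "e < 0"
        unfolding e_def using \<alpha>\<gamma> L(1) r by (intro large_size_exponent_neg[of \<gamma>]) auto
      then have "2 powr e < 1" using powr_less_mono[of e 0 2] by simp
      \<comment> \<open>No clique exists at these sizes, so values of \<open>h\<close> outside the
        Lipschitz range never enter.\<close>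
      with W have "W = 0" by linarith
      then show ?thesis by (simp add: W_def)
    next
      case True
      define s' where "s' = min q s"
      have s': "s' \<le> q" "s' \<le> s" "real s' \<le> L" "card C \<le> s'"
        using sL Cs Cr q by (auto simp: s'_def)
      have "\<bar>h q - h s'\<bar> \<le> \<bar>real q - real s'\<bar>"
      proof -
        have "q \<le> n" "s' \<le> n" "real s' \<le> 2.1 * log 2 (real n)" "real q \<le> 2.1 * log 2 (real n)"
          using True q s' L(1) by (auto simp: L_def)
        with h show ?thesis unfolding one_lipschitz_def by blast
      qed
      then have "h q - h s' \<le> real q - real s'" using s' by auto
      then have "\<beta> * (h q - h s') \<le> \<beta> * (real q - real s')" using \<beta> by (intro mult_left_mono)
      also have "\<dots> \<le> (ln 2 * \<gamma> * L) * (real q - real s')" using \<beta> s' by (intro mult_right_mono) auto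
      finally have "exp (\<beta> * (h q - h s')) \<le> 2 powr (\<gamma> * L * (real q - real s'))"
        by (simp add: powr_def algebra_simps)
      moreover have "(\<Prod>i = card C..<s'. real (Suc i) / N i) \<le>
          2 powr ((real s' - real (card C)) * (b - L) + real s' ^ 2 / 2)"
        unfolding N_def nL b_def using s' L(1) by (intro prod_ratio_le_powr) auto
      ultimately have "real W * (exp (\<beta> * (h q - h s')) * (\<Prod>i = card C..<s'. real (Suc i) / N i)) \<le>
          2 powr e * (2 powr (\<gamma> * L * (real q - real s')) *
            2 powr ((real s' - real (card C)) * (b - L) + real s' ^ 2 / 2))"
        using W n by (intro mult_mono prod_nonneg mult_nonneg_nonneg) (auto simp: N_def)
      also have "\<dots> = 2 powr (e + \<gamma> * L * (real q - real s') +
          ((real s' - real (card C)) * (b - L) + real s' ^ 2 / 2))"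
        by (simp add: powr_add)
      also have "\<dots> \<le> 2 powr X"
        unfolding e_def X_def D_def
        using True s' s(2) C(2) b \<alpha>\<gamma> L(1) r
        by (intro powr_mono crossing_exponent_le) (auto simp: s'_def D_def min_def)
      finally show ?thesis by (simp add: W_def s'_def)
    qed
  qed
  have ext': "N (card Y) \<le> real (card {v\<in>{..<n} - Y. insert v Y \<in> cliques {..<n} E})"
    if "Y \<in> cliques {..<n} E" "card Y < s" for Y
    using ext that by (auto simp: many_extensions_def N_def)
  have "measure_pmf.prob (metropolis_path {..<n} E h \<beta> C T) {Xs. \<exists>t\<le>T. r \<le> card (Xs ! t \<inter> K)} \<le>
    (real T + 1) * real T * (\<Sum>q = r..card {..<n}.
      real (card {Y \<in> cliques {..<n} E. card Y = q \<and> card (Y \<inter> K) = r}) *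
      (exp (\<beta> * (h q - h (min q s))) * (\<Prod>i = card C..<min q s. real (Suc i) / N i)))"
    using n C Cr Cs ext' by (intro prob_metropolis_path_crossing_le) (auto simp: N_def)
  also have "\<dots> \<le> (real T + 1) * real T * (\<Sum>q = r..card {..<n}. 2 powr X)"
    using term_le by (intro mult_left_mono sum_mono) auto
  also have "\<dots> = (real T + 1) * real T * (real (Suc n - r) * 2 powr X)" by simp
  also have "\<dots> \<le> (2 * 2 powr (D / 8 * L^2)) * 2 powr (D / 8 * L^2) * ((2 * 2 powr L) * 2 powr X)"
  proof -
    have T': "real T \<le> 2 powr (D / 8 * L^2)"
      using T by (simp add: nL powr_powr power2_eq_square algebra_simps)
    moreover have "1 \<le> 2 powr (D / 8 * L^2)" using D by (intro ge_one_powr_ge_zero) auto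
    ultimately have "real T + 1 \<le> 2 * 2 powr (D / 8 * L^2)" by linarith
    moreover have "real (Suc n - r) \<le> 2 * 2 powr L" using n unfolding nL[symmetric] by linarith
    ultimately show ?thesis using T' by (intro mult_mono) auto
  qed
  also have "\<dots> = 2 powr (2 + D / 4 * L^2 + L + X)"
    by (simp add: powr_add power2_eq_square mult_ac flip: powr_add) (simp add: powr_add)
  also have "\<dots> \<le> 2 powr (- (D / 8) * L^2)"
    using L(2) by (intro powr_mono) (auto simp: X_def b_def)
  also have "\<dots> = real n powr (- (D / 8) * L)"
    by (simp add: nL powr_powr power2_eq_square mult_ac)
  finally show ?thesis .
qed

section \<open>Choice of constants, slow crossing and failure of recovery\<close>

theorem theorem6p2:
  fixes \<alpha> \<gamma> :: real
  assumes "0 < \<alpha>" "\<alpha> < 1" and "0 < \<gamma>" "\<gamma> < 1 - \<alpha>"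
  shows
    "\<exists>\<xi>>0. \<exists>c>0.
       whp (planted_power_model \<alpha>) (\<lambda>n (E, PC).
         \<forall>h \<beta> C. one_lipschitz n h \<longrightarrow> h 0 = 0 \<longrightarrow> 0 \<le> \<beta> \<longrightarrow> \<beta> \<le> ln 2 * \<gamma> * log 2 (real n) \<longrightarrow>
           C \<in> cliques {..<n} E \<longrightarrow> real (card C) \<le> \<xi> * log 2 (real n) \<longrightarrow>
           measure_pmf.prob
             (metropolis_path {..<n} E h \<beta> C (nat \<lfloor>real n powr (c * log 2 (real n))\<rfloor>))
             {X. \<exists>t. real t \<le> real n powr (c * log 2 (real n)) \<and>
                     real (card (X ! t \<inter> PC)) \<ge> \<gamma> * log 2 (real n)}
           \<le> real n powr (- c * log 2 (real n))) \<and>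
       whp (planted_power_model \<alpha>) (\<lambda>n (E, PC).
         \<forall>h \<beta>. one_lipschitz n h \<longrightarrow> h 0 = 0 \<longrightarrow> 0 \<le> \<beta> \<longrightarrow> \<beta> \<le> ln 2 * \<gamma> * log 2 (real n) \<longrightarrow>
           measure_pmf.prob
             (metropolis_path {..<n} E h \<beta> {} (nat \<lfloor>real n powr (c * log 2 (real n))\<rfloor>))
             {X. \<forall>t. real t \<le> real n powr (c * log 2 (real n)) \<longrightarrow>
                     real (card (X ! t \<inter> PC)) < \<gamma> * log 2 (real n)}
           \<ge> 1 - real n powr (- c * log 2 (real n))) \<and>
       (\<forall>d::nat. whp (planted_power_model \<alpha>) (\<lambda>n (E, PC).
         \<forall>h \<beta> C. one_lipschitz n h \<longrightarrow> h 0 = 0 \<longrightarrow> 0 \<le> \<beta> \<longrightarrow> \<beta> \<le> ln 2 * \<gamma> * log 2 (real n) \<longrightarrow>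
           C \<in> cliques {..<n} E \<longrightarrow> real (card C) \<le> \<xi> * log 2 (real n) \<longrightarrow>
           measure_pmf.prob
             (metropolis_path {..<n} E h \<beta> C (n ^ d))
             {X. \<exists>t\<le>n ^ d. X ! t = PC}
           \<le> real n powr (- c * log 2 (real n))))"
proof -
  define D where "D = \<gamma> * (1 - \<alpha> - \<gamma>)"
  \<comment> \<open>One constant serves three purposes: \<xi>, the time exponent \<open>c\<close>,
    and the slack \<epsilon> in the sizes up to which extensions are guaranteed.\<close>
  define c where "c = D / 8"
  define L where "L = (\<lambda>n::nat. log 2 (real n))"
  define r where "r = (\<lambda>n. nat \<lceil>\<gamma> * L n\<rceil>)"
  have D: "0 < D" "D \<le> 1" unfolding D_def using assms by (auto intro!: mult_le_one)
  then have c: "0 < c" "c < 1" by (simp_all add: c_def)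
  \<comment> \<open>The horizon \<open>T\<close> is quantified inside, so one high-probability event
    covers the quasi-polynomial horizon and every polynomial one.\<close>
  define hitting where "hitting = (\<lambda>n E K.
    \<forall>h \<beta> C T. one_lipschitz n h \<longrightarrow> 0 \<le> \<beta> \<longrightarrow> \<beta> \<le> ln 2 * \<gamma> * L n \<longrightarrow>
      C \<in> cliques {..<n} E \<longrightarrow> real (card C) \<le> c * L n \<longrightarrow> real T \<le> real n powr (c * L n) \<longrightarrow>
      measure_pmf.prob (metropolis_path {..<n} E h \<beta> C T)
        {Xs. \<exists>t\<le>T. \<gamma> * L n \<le> real (card (Xs ! t \<inter> K))} \<le> real n powr (- c * L n))"
  have "\<forall>\<^sub>F x::real in at_top. 7 * x + 3 + x * log 2 (8 * x) \<le> D / 8 * x^2"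
    using D by real_asymp
  then have ev: "\<forall>\<^sub>F n in sequentially. 7 * L n + 3 + L n * log 2 (8 * L n) \<le> D / 8 * (L n)^2"
    using filterlim_log2_nat unfolding filterlim_iff L_def by blast
  have ev': "\<forall>\<^sub>F n in sequentially. 30 \<le> L n" unfolding L_def by real_asymp
  have "whp (planted_power_model \<alpha>) (\<lambda>n (E, K). hitting n E K)"
  proof (rule whp_mono[OF whp_typical[of \<alpha> c r]])
    show "\<forall>\<^sub>F n in sequentially. \<forall>x\<in>set_pmf (planted_power_model \<alpha> n).
      (case x of (E, K) \<Rightarrow>
        many_extensions {..<n} E (nat \<lfloor>(1 - c) * log 2 (real n)\<rfloor>) (\<lambda>i. real n * (1 / 2) ^ i / 8) \<and>
        few_crossing_cliques {..<n} E K (r n) (\<lambda>q. real n ^ 2 * (real (card K) ^ r n *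
          real n ^ (q - r n) * (1 / 2) ^ ((q choose 2) - (r n choose 2))))) \<longrightarrow>
      (case x of (E, K) \<Rightarrow> hitting n E K)"
      using ev ev'
    proof eventually_elim
      case (elim n)
      have n: "n > 0" using elim(2) by (cases n) (auto simp: L_def log_def)
      show ?case
      proof safe
        fix E K assume EK: "(E, K) \<in> set_pmf (planted_power_model \<alpha> n)"
        assume typical:
          "many_extensions {..<n} E (nat \<lfloor>(1 - c) * log 2 (real n)\<rfloor>) (\<lambda>i. real n * (1 / 2) ^ i / 8)"
          "few_crossing_cliques {..<n} E K (r n) (\<lambda>q. real n ^ 2 * (real (card K) ^ r n *
            real n ^ (q - r n) * (1 / 2) ^ ((q choose 2) - (r n choose 2))))"
        have K: "real (card K) \<le> real n powr \<alpha>"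
          using card_planted_power_model[OF assms(2) n EK] by simp
        show "hitting n E K"
          unfolding hitting_def
        proof (intro allI impI)
          fix h \<beta> C T
          assume *: "one_lipschitz n h" "0 \<le> \<beta>" "\<beta> \<le> ln 2 * \<gamma> * L n"
            "C \<in> cliques {..<n} E" "real (card C) \<le> c * L n" "real T \<le> real n powr (c * L n)"
          have "(\<gamma> * L n \<le> real m) = (r n \<le> m)" for m
            unfolding r_def by linarith
          then show "measure_pmf.prob (metropolis_path {..<n} E h \<beta> C T)
              {Xs. \<exists>t\<le>T. \<gamma> * L n \<le> real (card (Xs ! t \<inter> K))} \<le> real n powr (- c * L n)"
            using prob_metropolis_path_crossing_le_powr[of \<gamma> \<alpha> n K E h \<beta> C T] assms K elim typical *
            by (simp add: L_def r_def c_def D_def)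
        qed
      qed
    qed
  qed (use assms c in auto)
  note whp_hitting = this
  \<comment> \<open>The admissible real times are exactly the indices of the path with horizon
    \<open>nat \<lfloor>x\<rfloor>\<close>, so \<open>X ! t\<close> is never read out of
    range.\<close>
  have time: "real t \<le> x \<longleftrightarrow> t \<le> nat \<lfloor>x\<rfloor>" if "0 \<le> x" for t and x :: real
    using that by linarith
  have 1: "whp (planted_power_model \<alpha>) (\<lambda>n (E, PC).
         \<forall>h \<beta> C. one_lipschitz n h \<longrightarrow> h 0 = 0 \<longrightarrow> 0 \<le> \<beta> \<longrightarrow> \<beta> \<le> ln 2 * \<gamma> * log 2 (real n) \<longrightarrow>
           C \<in> cliques {..<n} E \<longrightarrow> real (card C) \<le> c * log 2 (real n) \<longrightarrow>
           measure_pmf.prob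
             (metropolis_path {..<n} E h \<beta> C (nat \<lfloor>real n powr (c * log 2 (real n))\<rfloor>))
             {X. \<exists>t. real t \<le> real n powr (c * log 2 (real n)) \<and>
                     real (card (X ! t \<inter> PC)) \<ge> \<gamma> * log 2 (real n)}
           \<le> real n powr (- c * log 2 (real n)))"
    by (rule whp_mono[OF whp_hitting]) (simp add: hitting_def L_def time split_beta)
  have 2: "whp (planted_power_model \<alpha>) (\<lambda>n (E, PC).
         \<forall>h \<beta>. one_lipschitz n h \<longrightarrow> h 0 = 0 \<longrightarrow> 0 \<le> \<beta> \<longrightarrow> \<beta> \<le> ln 2 * \<gamma> * log 2 (real n) \<longrightarrow>
           measure_pmf.prob
             (metropolis_path {..<n} E h \<beta> {} (nat \<lfloor>real n powr (c * log 2 (real n))\<rfloor>))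
             {X. \<forall>t. real t \<le> real n powr (c * log 2 (real n)) \<longrightarrow>
                     real (card (X ! t \<inter> PC)) < \<gamma> * log 2 (real n)}
           \<ge> 1 - real n powr (- c * log 2 (real n)))"
  proof (rule whp_mono[OF 1])
    \<comment> \<open>The second claim is the complementary event at \<open>C = {}\<close>, whose
      size 0 is admissible once the logarithm is nonnegative.\<close>
    have compl: "measure_pmf.prob M {X. \<forall>t. P t \<longrightarrow> Q X t < a} =
        1 - measure_pmf.prob M {X. \<exists>t. P t \<and> a \<le> Q X t}" for M :: "nat set list pmf" and P a
        and Q :: "nat set list \<Rightarrow> nat \<Rightarrow> real"
    proof -
      have *: "{X. \<forall>t. P t \<longrightarrow> Q X t < a} = space (measure_pmf M) - {X. \<exists>t. P t \<and> a \<le> Q X t}"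
        by (auto simp: not_le)
      show ?thesis unfolding * by (rule measure_pmf.prob_compl) simp
    qed
    show "\<forall>\<^sub>F n in sequentially. \<forall>x\<in>set_pmf (planted_power_model \<alpha> n).
      (case x of (E, PC) \<Rightarrow>
         \<forall>h \<beta> C. one_lipschitz n h \<longrightarrow> h 0 = 0 \<longrightarrow> 0 \<le> \<beta> \<longrightarrow> \<beta> \<le> ln 2 * \<gamma> * log 2 (real n) \<longrightarrow>
           C \<in> cliques {..<n} E \<longrightarrow> real (card C) \<le> c * log 2 (real n) \<longrightarrow>
           measure_pmf.prob
             (metropolis_path {..<n} E h \<beta> C (nat \<lfloor>real n powr (c * log 2 (real n))\<rfloor>))
             {X. \<exists>t. real t \<le> real n powr (c * log 2 (real n)) \<and>
                     real (card (X ! t \<inter> PC)) \<ge> \<gamma> * log 2 (real n)}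
           \<le> real n powr (- c * log 2 (real n))) \<longrightarrow>
      (case x of (E, PC) \<Rightarrow>
         \<forall>h \<beta>. one_lipschitz n h \<longrightarrow> h 0 = 0 \<longrightarrow> 0 \<le> \<beta> \<longrightarrow> \<beta> \<le> ln 2 * \<gamma> * log 2 (real n) \<longrightarrow>
           measure_pmf.prob
             (metropolis_path {..<n} E h \<beta> {} (nat \<lfloor>real n powr (c * log 2 (real n))\<rfloor>))
             {X. \<forall>t. real t \<le> real n powr (c * log 2 (real n)) \<longrightarrow>
                     real (card (X ! t \<inter> PC)) < \<gamma> * log 2 (real n)}
           \<ge> 1 - real n powr (- c * log 2 (real n)))"
      using ev'
    proof eventually_elim
      case (elim n)
      then have "0 \<le> c * log 2 (real n)" using c by (simp add: L_def)
      then show ?case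
        by (auto simp: compl empty_in_cliques)
    qed
  qed
  have 3: "whp (planted_power_model \<alpha>) (\<lambda>n (E, PC).
         \<forall>h \<beta> C. one_lipschitz n h \<longrightarrow> h 0 = 0 \<longrightarrow> 0 \<le> \<beta> \<longrightarrow> \<beta> \<le> ln 2 * \<gamma> * log 2 (real n) \<longrightarrow>
           C \<in> cliques {..<n} E \<longrightarrow> real (card C) \<le> c * log 2 (real n) \<longrightarrow>
           measure_pmf.prob
             (metropolis_path {..<n} E h \<beta> C (n ^ d))
             {X. \<exists>t\<le>n ^ d. X ! t = PC}
           \<le> real n powr (- c * log 2 (real n)))" for d
  \<comment> \<open>For large \<open>n\<close>, the time \<open>n ^ d\<close> lies within the
    horizon. At the state \<open>PC\<close> the intersection is all of \<open>PC\<close>, whose size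
    is the floor of \<open>n powr \<alpha>\<close> and hence at least the level; the
    \<open>+ 1\<close> below pays for the floor.\<close>
  proof (rule whp_mono[OF whp_hitting])
    have "\<forall>\<^sub>F n in sequentially. real d \<le> c * L n" unfolding L_def using c by real_asymp
    moreover have "\<forall>\<^sub>F n in sequentially. \<gamma> * L n + 1 \<le> real n powr \<alpha>"
      unfolding L_def using assms by real_asymp
    ultimately show "\<forall>\<^sub>F n in sequentially. \<forall>x\<in>set_pmf (planted_power_model \<alpha> n).
      (case x of (E, K) \<Rightarrow> hitting n E K) \<longrightarrow> (case x of (E, PC) \<Rightarrow>
         \<forall>h \<beta> C. one_lipschitz n h \<longrightarrow> h 0 = 0 \<longrightarrow> 0 \<le> \<beta> \<longrightarrow> \<beta> \<le> ln 2 * \<gamma> * log 2 (real n) \<longrightarrow>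
           C \<in> cliques {..<n} E \<longrightarrow> real (card C) \<le> c * log 2 (real n) \<longrightarrow>
           measure_pmf.prob
             (metropolis_path {..<n} E h \<beta> C (n ^ d))
             {X. \<exists>t\<le>n ^ d. X ! t = PC}
           \<le> real n powr (- c * log 2 (real n)))"
      using eventually_gt_at_top[of 0]
    proof eventually_elim
      case (elim n)
      have T: "real (n ^ d) \<le> real n powr (c * L n)"
      proof -
        have "real (n ^ d) = real n powr real d" using elim(3) by (simp add: powr_realpow)
        also have "\<dots> \<le> real n powr (c * L n)" using elim by (intro powr_mono) auto
        finally show ?thesis .
      qed
      show ?case
      proof safe
        fix E K h \<beta> C
        assume EK: "(E, K) \<in> set_pmf (planted_power_model \<alpha> n)" and hit: "hitting n E K"
          and *: "one_lipschitz n h" "0 \<le> \<beta>" "\<beta> \<le> ln 2 * \<gamma> * log 2 (real n)"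
            "C \<in> cliques {..<n} E" "real (card C) \<le> c * log 2 (real n)"
        have "\<gamma> * L n \<le> real (card K)"
          using card_planted_power_model[OF assms(2) elim(3) EK] elim(2) by linarith
        then have "measure_pmf.prob (metropolis_path {..<n} E h \<beta> C (n ^ d)) {X. \<exists>t\<le>n ^ d. X ! t = K} \<le>
            measure_pmf.prob (metropolis_path {..<n} E h \<beta> C (n ^ d))
              {X. \<exists>t\<le>n ^ d. \<gamma> * L n \<le> real (card (X ! t \<inter> K))}"
          by (intro measure_pmf.finite_measure_mono) auto
        also have "\<dots> \<le> real n powr (- c * L n)"
          using hit * T unfolding hitting_def L_def by blast
        finally show "measure_pmf.prob (metropolis_path {..<n} E h \<beta> C (n ^ d)) {X. \<exists>t\<le>n ^ d. X ! t = K}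
            \<le> real n powr (- c * log 2 (real n))"
          by (simp add: L_def)
      qed
    qed
  qed
  from c(1) 1 2 3 show ?thesis by blast
qed

end
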